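(* Let $D\subset\subset\mathbb{C}$ be a bounded domain, $1\le p\le\infty$, $s\in\mathbb{R}$, and let $k=k(p,s)\in\mathbb{Z}$ be the $\overline{\partial}$-weight of $(p,s)$. Then $\mathbf{I}_k^D$ is a bounded linear operator $$\mathbf{I}_k^D:\ |z|^sL^p(D)\rightarrow|z|^{s+1-\epsilon}L^p(D)\quad\text{for all }\epsilon>0.$$
   Context: For $t\in\mathbb{R}$, $|z|^tL^p(D)$ is the Banach space of measurable functions $f$ on $D$ with $|z|^{-t}f\in L^p(D)$, with norm $\|f\|_{|z|^tL^p(D)}=\||z|^{-t}f\|_{L^p(D)}$; $|z|^tL^p_{loc}(\mathbb{C})$ is the space of measurable $f$ with $|z|^{-t}f\in L^p_{loc}(\mathbb{C})$. The $\overline{\partial}$-weight of $(p,s)$ is $k(p,s):=\max\{m\in\mathbb{Z}:|z|^sL^p_{loc}(\mathbb{C})\subset|z|^mL^1_{loc}(\mathbb{C})\}$. For $k\in\mathbb{Z}$ and a measurable function $f$ on $D$, $$\mathbf{I}_k^Df(z):=\frac{z^k}{2\pi i}\int_Df(\zeta)\,\frac{d\zeta\wedge d\overline{\zeta}}{\zeta^k(\zeta-z)},$$ provided the integral exists. *)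

theory Defs
  imports "HOL-Probability.Essential_Supremum"
begin

text \<open>
  Elements of an \<open>L\<^sup>p\<close> space are represented by measurable functions, and equality of elements is
  equality almost everywhere. The exponent \<open>p\<close> is an extended nonnegative real, with \<open>\<infinity>\<close> allowed.
\<close>

definition Lp_space :: "ennreal \<Rightarrow> 'a measure \<Rightarrow> ('a \<Rightarrow> complex) set" where
  "Lp_space p M = {f \<in> borel_measurable M.
     if p = \<infinity> then esssup M (\<lambda>x. ennreal (cmod (f x))) < \<infinity>
     else integrable M (\<lambda>x. cmod (f x) powr enn2real p)}"

definition Lp_norm :: "ennreal \<Rightarrow> 'a measure \<Rightarrow> ('a \<Rightarrow> complex) \<Rightarrow> real" where
  "Lp_norm p M f =
     (if p = \<infinity> then enn2real (esssup M (\<lambda>x. ennreal (cmod (f x))))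
      else (LINT x|M. cmod (f x) powr enn2real p) powr (1 / enn2real p))"

text \<open>Since \<open>0 powr a = 0\<close>, the function below vanishes at the origin, which is a null set.\<close>

definition unweight :: "real \<Rightarrow> (complex \<Rightarrow> complex) \<Rightarrow> complex \<Rightarrow> complex" where
  "unweight t f = (\<lambda>z. of_real (cmod z powr (- t)) * f z)"

definition weighted_Lp :: "real \<Rightarrow> ennreal \<Rightarrow> complex set \<Rightarrow> (complex \<Rightarrow> complex) set" where
  "weighted_Lp t p D =
     {f \<in> borel_measurable (lebesgue_on D). unweight t f \<in> Lp_space p (lebesgue_on D)}"

definition weighted_Lp_norm :: "real \<Rightarrow> ennreal \<Rightarrow> complex set \<Rightarrow> (complex \<Rightarrow> complex) \<Rightarrow> real" where
  "weighted_Lp_norm t p D f = Lp_norm p (lebesgue_on D) (unweight t f)"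

definition weighted_Lp_loc :: "real \<Rightarrow> ennreal \<Rightarrow> (complex \<Rightarrow> complex) set" where
  "weighted_Lp_loc t p =
     {f \<in> borel_measurable lebesgue. \<forall>K. compact K \<longrightarrow> unweight t f \<in> Lp_space p (lebesgue_on K)}"

definition dbar_weight :: "ennreal \<Rightarrow> real \<Rightarrow> int" where
  "dbar_weight p s = (GREATEST m. weighted_Lp_loc s p \<subseteq> weighted_Lp_loc (of_int m) 1)"

text \<open>
  The factor \<open>- 2 * \<i>\<close> is the density of the form \<open>d\<zeta> \<and> d(cnj \<zeta>)\<close> with respect to Lebesgue measure:
  for \<open>\<zeta> = x + \<i> y\<close> it equals \<open>(dx + \<i> dy) \<and> (dx - \<i> dy) = - 2 \<i> dx \<and> dy\<close>.
\<close>

definition dbar_integrand :: "int \<Rightarrow> (complex \<Rightarrow> complex) \<Rightarrow> complex \<Rightarrow> complex \<Rightarrow> complex" where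
  "dbar_integrand k f z = (\<lambda>\<zeta>. f \<zeta> / (\<zeta> powi k * (\<zeta> - z)) * (- 2 * \<i>))"

text \<open>Where the integral does not exist, the value of the following operator is the junk value \<open>0\<close>.\<close>

definition dbar_op :: "int \<Rightarrow> complex set \<Rightarrow> (complex \<Rightarrow> complex) \<Rightarrow> complex \<Rightarrow> complex" where
  "dbar_op k D f z =
     z powi k / (2 * of_real pi * \<i>) * (LINT \<zeta>|lebesgue_on D. dbar_integrand k f z \<zeta>)"

text \<open>
  \<open>T\<close> induces a bounded complex-linear operator from \<open>|z|\<^sup>t L\<^sup>p(D)\<close> to \<open>|z|\<^sup>u L\<^sup>q(D)\<close>. As elements are
  classes of functions modulo equality almost everywhere, \<open>T\<close> has to respect this equality, and
  linearity is required almost everywhere.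
\<close>

definition bounded_linear_weighted_Lp ::
  "real \<Rightarrow> ennreal \<Rightarrow> real \<Rightarrow> ennreal \<Rightarrow> complex set
    \<Rightarrow> ((complex \<Rightarrow> complex) \<Rightarrow> complex \<Rightarrow> complex) \<Rightarrow> bool" where
  "bounded_linear_weighted_Lp t p u q D T \<longleftrightarrow>
     (\<forall>f \<in> weighted_Lp t p D. T f \<in> weighted_Lp u q D) \<and>
     (\<forall>f \<in> weighted_Lp t p D. \<forall>g \<in> weighted_Lp t p D.
        (AE z in lebesgue_on D. f z = g z) \<longrightarrow> (AE z in lebesgue_on D. T f z = T g z)) \<and>
     (\<forall>f \<in> weighted_Lp t p D. \<forall>g \<in> weighted_Lp t p D.
        AE z in lebesgue_on D. T (\<lambda>w. f w + g w) z = T f z + T g z) \<and>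
     (\<forall>c. \<forall>f \<in> weighted_Lp t p D. AE z in lebesgue_on D. T (\<lambda>w. c * f w) z = c * T f z) \<and>
     (\<exists>C. \<forall>f \<in> weighted_Lp t p D. weighted_Lp_norm u q D (T f) \<le> C * weighted_Lp_norm t p D f)"

end

theory Submission
  imports Defs
begin

text \<open>
  Write an element of \<open>\<bar>z\<bar>\<^sup>s L\<^sup>p(D)\<close> as \<open>\<bar>z\<bar>\<^sup>s g\<close> with \<open>g\<close> in \<open>L\<^sup>p(D)\<close>, and put \<open>\<sigma> = s - k\<close>. After taking absolute
  values, the theorem is about an integral operator on the ordinary space \<open>L\<^sup>p(D)\<close>: its kernel is
  \<open>\<bar>z\<bar>\<^sup>e\<^sup>-\<^sup>1\<^sup>-\<^sup>\<sigma> \<bar>y\<bar>\<^sup>\<sigma> / \<bar>y - z\<bar>\<close>, homogeneous of degree \<open>e - 2\<close>. As \<open>D\<close> is bounded, the loss \<open>e\<close> may be chosen smaller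
  than the given \<open>\<epsilon>\<close>. Boundedness of this positive operator also gives the existence of the integral
  almost everywhere, and linearity of the operator then reduces to linearity of the integral.
  
  Two facts carry the proof. The first one is an explicit value of the weight, \<open>dbar_weight_eq\<close>:
  for \<open>p > 1\<close>, the inclusion that defines it holds for \<open>m\<close> if and only if \<open>m < s + 2 - 2/p\<close>, by duality in one
  direction and by step functions on dyadic annuli in the other one. It yields
  \<open>- (2 - 2/p) < \<sigma> \<le> 2/p - 1\<close>, and \<open>0 \<le> \<sigma> \<le> 1\<close> for \<open>p = 1\<close>.
  
  The second one is the elementary inequality \<open>homogeneous_kernel_le\<close>, by which \<open>\<bar>y\<bar>\<^sup>a / \<bar>y - z\<bar>\<close> is at
  most a power of \<open>\<bar>z\<bar>\<close> times \<open>\<bar>y\<bar>\<^sup>e\<^sup>-\<^sup>2 + \<bar>y - z\<bar>\<^sup>e\<^sup>-\<^sup>2\<close>. The gain of \<open>e\<close> makes the last sum integrable over bounded sets,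
  uniformly in \<open>z\<close>. So rows and columns of the kernel, multiplied by powers of \<open>\<bar>z\<bar>\<close>, have explicitly bounded
  integrals. This settles \<open>p = 1\<close> and \<open>p = \<infinity>\<close> directly and \<open>1 < p < \<infinity>\<close> by \<open>Schur_test\<close> with a power of
  \<open>\<bar>z\<bar>\<close> as weight; the two bounds on \<open>\<sigma>\<close> are what a suitable power needs in order to exist.
\<close>

section \<open>Lebesgue spaces with exponents up to infinity\<close>

lemma enn2real_ge_one:
  assumes "1 \<le> p" "p \<noteq> \<infinity>"
  shows "1 \<le> enn2real p"
  using enn2real_mono[of 1 p] assms by (simp add: less_top)

lemma enn2real_gt_one:
  assumes "1 \<le> p" "p \<noteq> 1" "p \<noteq> \<infinity>"
  shows "1 < enn2real p"
proof -
  have "p = ennreal (enn2real p)" using assms by (simp add: less_top)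
  then have "enn2real p \<noteq> 1" using assms(2) by (metis ennreal_1)
  then show ?thesis using enn2real_ge_one[OF assms(1,3)] by linarith
qed

lemma Lp_space_measurable: "f \<in> Lp_space p M \<Longrightarrow> f \<in> borel_measurable M"
  by (simp add: Lp_space_def)

lemma Lp_finite_iff:
  assumes "p \<noteq> \<infinity>"
  shows "f \<in> Lp_space p M \<longleftrightarrow> f \<in> borel_measurable M \<and>
    (\<integral>\<^sup>+ x. ennreal (cmod (f x) powr enn2real p) \<partial>M) < \<infinity>"
  using assms by (auto simp: Lp_space_def integrable_iff_bounded)

lemma Lp_norm_nonneg: "0 \<le> Lp_norm p M f"
  by (simp add: Lp_norm_def)

lemma nn_integral_Lp_norm:
  assumes "1 \<le> p" "p \<noteq> \<infinity>" "f \<in> Lp_space p M"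
  shows "(\<integral>\<^sup>+ x. ennreal (cmod (f x) powr enn2real p) \<partial>M) = ennreal (Lp_norm p M f powr enn2real p)"
proof -
  have "(\<integral>\<^sup>+ x. ennreal (cmod (f x) powr enn2real p) \<partial>M)
      = ennreal (LINT x|M. cmod (f x) powr enn2real p)"
    using assms by (intro nn_integral_eq_integral) (auto simp: Lp_space_def)
  then show ?thesis
    using assms enn2real_ge_one[of p] by (simp add: Lp_norm_def powr_powr)
qed

text \<open>
  The form in which norm bounds are obtained below: a bound between Lebesgue integrals of
  nonnegative functions gives membership and the norm estimate at once, with no integrability
  to be checked first. \<open>Lp_top_leI\<close> is the counterpart for the exponent \<open>\<infinity>\<close>.
\<close>

lemma Lp_norm_leI:
  assumes p: "1 \<le> p" "p \<noteq> \<infinity>" and f: "f \<in> borel_measurable M" and B: "0 \<le> B"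
    and le: "(\<integral>\<^sup>+ x. ennreal (cmod (f x) powr enn2real p) \<partial>M) \<le> ennreal (B powr enn2real p)"
  shows "f \<in> Lp_space p M" "Lp_norm p M f \<le> B"
proof -
  show *: "f \<in> Lp_space p M"
    using le f p by (auto simp: Lp_finite_iff intro: le_less_trans)
  have "Lp_norm p M f powr enn2real p \<le> B powr enn2real p"
    using le nn_integral_Lp_norm[OF p *] by (simp add: ennreal_le_iff)
  then show "Lp_norm p M f \<le> B"
    using enn2real_ge_one[OF p] B Lp_norm_nonneg[of p M f] powr_le_cancel_iff
    by (smt (verit) powr_less_mono2)
qed

lemma Lp_top_AE:
  assumes "f \<in> Lp_space \<infinity> M"
  shows "AE x in M. cmod (f x) \<le> Lp_norm \<infinity> M f"
proof -
  have fin: "esssup M (\<lambda>x. ennreal (cmod (f x))) < \<infinity>"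
    using assms by (simp add: Lp_space_def)
  have "AE x in M. ennreal (cmod (f x)) \<le> esssup M (\<lambda>x. ennreal (cmod (f x)))"
    by (rule esssup_AE)
  then show ?thesis
  proof (rule AE_mp, intro AE_I2 impI)
    fix x assume "ennreal (cmod (f x)) \<le> esssup M (\<lambda>x. ennreal (cmod (f x)))"
    then show "cmod (f x) \<le> Lp_norm \<infinity> M f"
      using enn2real_mono[OF _ fin[simplified]] by (fastforce simp: Lp_norm_def)
  qed
qed

lemma Lp_top_leI:
  assumes f: "f \<in> borel_measurable M" and le: "AE x in M. cmod (f x) \<le> B" and "0 \<le> B"
  shows "f \<in> Lp_space \<infinity> M" "Lp_norm \<infinity> M f \<le> B"
proof -
  have *: "esssup M (\<lambda>x. ennreal (cmod (f x))) \<le> ennreal B"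
    using f le by (intro esssup_I) (auto elim!: eventually_mono simp: ennreal_leI)
  then show "f \<in> Lp_space \<infinity> M"
    using f by (auto simp: Lp_space_def intro: le_less_trans)
  show "Lp_norm \<infinity> M f \<le> B"
    using enn2real_mono[OF *] \<open>0 \<le> B\<close> by (simp add: Lp_norm_def)
qed

lemma Lp_dominated:
  assumes H: "H \<in> Lp_space p M" and p: "1 \<le> p" and f: "f \<in> borel_measurable M" and c: "0 \<le> c"
    and le: "AE x in M. cmod (f x) \<le> c * cmod (H x)"
  shows "f \<in> Lp_space p M" "Lp_norm p M f \<le> c * Lp_norm p M H"
proof -
  have "f \<in> Lp_space p M \<and> Lp_norm p M f \<le> c * Lp_norm p M H"
  proof (cases "p = \<infinity>")
    case True
    have "AE x in M. cmod (f x) \<le> c * Lp_norm \<infinity> M H"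
      using Lp_top_AE[OF H[unfolded True]] le
      by eventually_elim (meson c mult_left_mono order_trans)
    then show ?thesis
      using Lp_top_leI[OF f, of "c * Lp_norm \<infinity> M H"] True c by (simp add: Lp_norm_nonneg)
  next
    case False
    let ?P = "enn2real p"
    have P: "1 \<le> ?P" using enn2real_ge_one p False by blast
    have "(\<integral>\<^sup>+ x. ennreal (cmod (f x) powr ?P) \<partial>M)
       \<le> (\<integral>\<^sup>+ x. ennreal (c powr ?P) * ennreal (cmod (H x) powr ?P) \<partial>M)"
    proof (rule nn_integral_mono_AE)
      show "AE x in M. ennreal (cmod (f x) powr ?P) \<le> ennreal (c powr ?P) * ennreal (cmod (H x) powr ?P)"
        using le
      proof eventually_elim
        case (elim x)
        have "cmod (f x) powr ?P \<le> (c * cmod (H x)) powr ?P"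
          using elim P by (intro powr_mono2) auto
        then show ?case
          using c by (simp add: powr_mult flip: ennreal_mult')
      qed
    qed
    also have "\<dots> = ennreal (c powr ?P) * (\<integral>\<^sup>+ x. ennreal (cmod (H x) powr ?P) \<partial>M)"
      using Lp_space_measurable[OF H] by (intro nn_integral_cmult) simp
    also have "\<dots> = ennreal ((c * Lp_norm p M H) powr ?P)"
      using nn_integral_Lp_norm[OF p False H] c by (simp add: powr_mult Lp_norm_nonneg ennreal_mult')
    finally show ?thesis
      using Lp_norm_leI[OF p False f, of "c * Lp_norm p M H"] c by (simp add: Lp_norm_nonneg)
  qed
  then show "f \<in> Lp_space p M" "Lp_norm p M f \<le> c * Lp_norm p M H" by auto
qed

text \<open>
  Hoelder's inequality with upper bounds \<open>A\<close> and \<open>B\<close> in place of the two integrals. After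
  normalising \<open>f\<close> and \<open>h\<close> by \<open>A powr (1 / q)\<close> and \<open>B powr (1 / r)\<close> it is the integral of Young's
  inequality; if one bound is \<open>0\<close>, that factor vanishes almost everywhere.
\<close>

lemma nn_integral_Holder:
  fixes f h :: "'a \<Rightarrow> real" and q r A B :: real
  assumes q: "1 < q" "1 < r" "1 / q + 1 / r = 1"
    and [measurable]: "f \<in> borel_measurable M" "h \<in> borel_measurable M"
    and pos: "\<And>x. 0 \<le> f x" "\<And>x. 0 \<le> h x" and AB: "0 \<le> A" "0 \<le> B"
    and A: "(\<integral>\<^sup>+ x. ennreal (f x powr q) \<partial>M) \<le> ennreal A"
    and B: "(\<integral>\<^sup>+ x. ennreal (h x powr r) \<partial>M) \<le> ennreal B"
  shows "(\<integral>\<^sup>+ x. ennreal (f x * h x) \<partial>M) \<le> ennreal (A powr (1 / q) * B powr (1 / r))"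
proof (cases "A = 0 \<or> B = 0")
  case True
  have "AE x in M. f x * h x = 0"
    using True
  proof
    assume "A = 0"
    then have "AE x in M. ennreal (f x powr q) = 0"
      using A by (simp add: nn_integral_0_iff_AE)
    then show ?thesis by eventually_elim (auto simp: powr_eq_0_iff ennreal_eq_0_iff antisym)
  next
    assume "B = 0"
    then have "AE x in M. ennreal (h x powr r) = 0"
      using B by (simp add: nn_integral_0_iff_AE)
    then show ?thesis by eventually_elim (auto simp: powr_eq_0_iff ennreal_eq_0_iff antisym)
  qed
  then have "(\<integral>\<^sup>+ x. ennreal (f x * h x) \<partial>M) = (\<integral>\<^sup>+ x. 0 \<partial>M)"
    by (intro nn_integral_cong_AE) auto
  then show ?thesis by simp
next
  case False
  define a where "a = A powr (1 / q)"
  define b where "b = B powr (1 / r)"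
  have ab: "0 < a" "0 < b" using False AB by (auto simp: a_def b_def)
  have aq: "a powr q = A" and br: "b powr r = B"
    using q AB by (auto simp: a_def b_def powr_powr)
  have "(\<integral>\<^sup>+ x. ennreal (f x * h x) \<partial>M)
      \<le> (\<integral>\<^sup>+ x. ennreal (a * b / (q * A)) * ennreal (f x powr q) + ennreal (a * b / (r * B)) * ennreal (h x powr r) \<partial>M)"
  proof (rule nn_integral_mono)
    fix x
    have "(f x / a) * (h x / b) \<le> (f x / a) powr q / q + (h x / b) powr r / r"
      using q ab pos by (intro Youngs_inequality) auto
    also have "\<dots> = f x powr q / (q * A) + h x powr r / (r * B)"
      using pos ab by (simp add: powr_divide aq br mult.commute)
    finally have "a * b * ((f x / a) * (h x / b)) \<le> a * b * (f x powr q / (q * A) + h x powr r / (r * B))"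
      using ab by (intro mult_left_mono) auto
    then have "f x * h x \<le> a * b / (q * A) * (f x powr q) + a * b / (r * B) * (h x powr r)"
      using ab by (simp add: algebra_simps)
    then show "ennreal (f x * h x) \<le> ennreal (a * b / (q * A)) * ennreal (f x powr q) + ennreal (a * b / (r * B)) * ennreal (h x powr r)"
      using ab q AB by (simp flip: ennreal_mult' ennreal_plus)
  qed
  also have "\<dots> = ennreal (a * b / (q * A)) * (\<integral>\<^sup>+ x. ennreal (f x powr q) \<partial>M)
      + ennreal (a * b / (r * B)) * (\<integral>\<^sup>+ x. ennreal (h x powr r) \<partial>M)"
    by (simp add: nn_integral_add nn_integral_cmult)
  also have "\<dots> \<le> ennreal (a * b / (q * A)) * ennreal A + ennreal (a * b / (r * B)) * ennreal B"
    using A B by (intro add_mono mult_left_mono) auto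
  also have "\<dots> = ennreal (a * b / (q * A) * A + a * b / (r * B) * B)"
    using ab q AB by (simp flip: ennreal_mult' ennreal_plus)
  also have "a * b / (q * A) * A + a * b / (r * B) * B = a * b * (1 / q + 1 / r)"
    using False by (simp add: field_simps)
  finally show ?thesis using q by (simp add: a_def b_def)
qed

section \<open>Positive kernels and the Schur test\<close>

text \<open>
  The value is an extended nonnegative number, so that it exists before anything is known about
  convergence.
\<close>

definition kernel_op :: "'a measure \<Rightarrow> ('a \<Rightarrow> 'a \<Rightarrow> real) \<Rightarrow> ('a \<Rightarrow> complex) \<Rightarrow> 'a \<Rightarrow> ennreal" where
  "kernel_op M K g x = (\<integral>\<^sup>+ y. ennreal (K x y * cmod (g y)) \<partial>M)"

text \<open>
  Finiteness almost everywhere has to be demanded separately, because \<open>enn2real\<close> sends \<open>\<infinity>\<close> to \<open>0\<close>.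
\<close>

definition Lp_bounded_kernel :: "ennreal \<Rightarrow> 'a measure \<Rightarrow> ('a \<Rightarrow> 'a \<Rightarrow> real) \<Rightarrow> bool" where
  "Lp_bounded_kernel p M K \<longleftrightarrow> (\<exists>C\<ge>0. \<forall>g\<in>Lp_space p M.
     (AE x in M. kernel_op M K g x < \<infinity>) \<and>
     (\<lambda>x. complex_of_real (enn2real (kernel_op M K g x))) \<in> Lp_space p M \<and>
     Lp_norm p M (\<lambda>x. complex_of_real (enn2real (kernel_op M K g x))) \<le> C * Lp_norm p M g)"

lemma kernel_op_measurable:
  assumes "sigma_finite_measure M" and "case_prod K \<in> borel_measurable (M \<Otimes>\<^sub>M M)"
    and "g \<in> borel_measurable M"
  shows "kernel_op M K g \<in> borel_measurable M"
proof -
  interpret sigma_finite_measure M by fact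
  note [measurable] = assms(2,3) measurable_compose[OF measurable_snd assms(3)]
  have "(\<lambda>(x, y). ennreal (K x y * cmod (g y))) \<in> borel_measurable (M \<Otimes>\<^sub>M M)"
    by measurable
  then show ?thesis unfolding kernel_op_def by measurable
qed

lemma Lp_bounded_kernel_top:
  assumes M: "sigma_finite_measure M" and K: "case_prod K \<in> borel_measurable (M \<Otimes>\<^sub>M M)"
    and pos: "\<And>x y. 0 \<le> K x y" and C: "0 \<le> C"
    and le: "\<And>x. x \<in> space M \<Longrightarrow> (\<integral>\<^sup>+ y. ennreal (K x y) \<partial>M) \<le> ennreal C"
  shows "Lp_bounded_kernel \<infinity> M K"
  unfolding Lp_bounded_kernel_def
proof (intro exI[of _ C] conjI ballI)
  show "0 \<le> C" by fact
  fix g assume g: "g \<in> Lp_space \<infinity> M"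
  note [measurable] = K Lp_space_measurable[OF g]
  have m: "kernel_op M K g \<in> borel_measurable M"
    using kernel_op_measurable[OF M K Lp_space_measurable[OF g]] .
  have *: "kernel_op M K g x \<le> ennreal (C * Lp_norm \<infinity> M g)" if x: "x \<in> space M" for x
  proof -
    have [measurable]: "K x \<in> borel_measurable M"
      using measurable_compose[OF measurable_Pair1'[OF x] K] by simp
    have "kernel_op M K g x \<le> (\<integral>\<^sup>+ y. ennreal (K x y) * ennreal (Lp_norm \<infinity> M g) \<partial>M)"
      unfolding kernel_op_def
    proof (rule nn_integral_mono_AE)
      show "AE y in M. ennreal (K x y * cmod (g y)) \<le> ennreal (K x y) * ennreal (Lp_norm \<infinity> M g)"
        using Lp_top_AE[OF g]
        by eventually_elim (use pos in \<open>simp add: Lp_norm_nonneg mult_left_mono flip: ennreal_mult'\<close>)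
    qed
    also have "\<dots> = (\<integral>\<^sup>+ y. ennreal (K x y) \<partial>M) * ennreal (Lp_norm \<infinity> M g)"
      by (rule nn_integral_multc) measurable
    also have "\<dots> \<le> ennreal C * ennreal (Lp_norm \<infinity> M g)"
      using le[OF x] by (rule mult_right_mono) simp
    finally show ?thesis using C by (simp add: ennreal_mult')
  qed
  show "AE x in M. kernel_op M K g x < \<infinity>"
    using * by (auto intro!: AE_I2 le_less_trans[OF *])
  have "AE x in M. cmod (complex_of_real (enn2real (kernel_op M K g x))) \<le> C * Lp_norm \<infinity> M g"
    using enn2real_mono[OF *] C by (auto intro!: AE_I2 simp: Lp_norm_nonneg)
  from Lp_top_leI[OF _ this]
  show "(\<lambda>x. complex_of_real (enn2real (kernel_op M K g x))) \<in> Lp_space \<infinity> M"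
    and "Lp_norm \<infinity> M (\<lambda>x. complex_of_real (enn2real (kernel_op M K g x))) \<le> C * Lp_norm \<infinity> M g"
    using m C by (auto simp: Lp_norm_nonneg)
qed

lemma Lp_bounded_kernel_finiteI:
  assumes p: "1 \<le> p" "p \<noteq> \<infinity>" and M: "sigma_finite_measure M"
    and K: "case_prod K \<in> borel_measurable (M \<Otimes>\<^sub>M M)" and C: "0 \<le> C"
    and fin: "\<And>g. g \<in> Lp_space p M \<Longrightarrow> AE x in M. kernel_op M K g x < \<infinity>"
    and le: "\<And>g. g \<in> Lp_space p M \<Longrightarrow>
        (\<integral>\<^sup>+ x. ennreal (enn2real (kernel_op M K g x) powr enn2real p) \<partial>M)
          \<le> ennreal C * (\<integral>\<^sup>+ x. ennreal (cmod (g x) powr enn2real p) \<partial>M)"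
  shows "Lp_bounded_kernel p M K"
  unfolding Lp_bounded_kernel_def
proof (intro exI[of _ "C powr (1 / enn2real p)"] conjI ballI)
  let ?P = "enn2real p"
  have P: "1 \<le> ?P" using enn2real_ge_one[OF p] .
  show "0 \<le> C powr (1 / ?P)" by simp
  fix g assume g: "g \<in> Lp_space p M"
  show "AE x in M. kernel_op M K g x < \<infinity>" using fin[OF g] .
  have [measurable]: "kernel_op M K g \<in> borel_measurable M"
    using kernel_op_measurable[OF M K Lp_space_measurable[OF g]] .
  have "(\<integral>\<^sup>+ x. ennreal (cmod (complex_of_real (enn2real (kernel_op M K g x))) powr ?P) \<partial>M)
      \<le> ennreal ((C powr (1 / ?P) * Lp_norm p M g) powr ?P)"
    using le[OF g] nn_integral_Lp_norm[OF p g] C P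
    by (simp add: powr_mult powr_powr Lp_norm_nonneg flip: ennreal_mult')
  from Lp_norm_leI[OF p _ _ this]
  show "(\<lambda>x. complex_of_real (enn2real (kernel_op M K g x))) \<in> Lp_space p M"
    and "Lp_norm p M (\<lambda>x. complex_of_real (enn2real (kernel_op M K g x)))
      \<le> C powr (1 / ?P) * Lp_norm p M g"
    by (auto simp: Lp_norm_nonneg)
qed

text \<open>
  By Tonelli, the integral of \<open>kernel_op M K g\<close> is the integral of \<open>cmod (g y)\<close> times the column
  integral of \<open>K\<close> at \<open>y\<close>.
\<close>

lemma Lp_bounded_kernel_one:
  assumes M: "sigma_finite_measure M" and K: "case_prod K \<in> borel_measurable (M \<Otimes>\<^sub>M M)"
    and pos: "\<And>x y. 0 \<le> K x y" and C: "0 \<le> C"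
    and le: "\<And>y. y \<in> space M \<Longrightarrow> (\<integral>\<^sup>+ x. ennreal (K x y) \<partial>M) \<le> ennreal C"
  shows "Lp_bounded_kernel 1 M K"
proof (rule Lp_bounded_kernel_finiteI[OF _ _ M K C])
  interpret pair_sigma_finite M M using M by (simp add: pair_sigma_finite_def)
  fix g assume g: "g \<in> Lp_space 1 M"
  note [measurable] = K Lp_space_measurable[OF g]
  have m [measurable]: "kernel_op M K g \<in> borel_measurable M"
    using kernel_op_measurable[OF M K Lp_space_measurable[OF g]] .
  have "(\<integral>\<^sup>+ x. kernel_op M K g x \<partial>M) = (\<integral>\<^sup>+ x. (\<integral>\<^sup>+ y. ennreal (K x y * cmod (g y)) \<partial>M) \<partial>M)"
    by (simp add: kernel_op_def)
  also have "\<dots> = (\<integral>\<^sup>+ y. (\<integral>\<^sup>+ x. ennreal (K x y * cmod (g y)) \<partial>M) \<partial>M)"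
    by (rule Fubini'[symmetric]) measurable
  also have "\<dots> \<le> (\<integral>\<^sup>+ y. ennreal C * ennreal (cmod (g y)) \<partial>M)"
  proof (rule nn_integral_mono)
    fix y assume y: "y \<in> space M"
    have [measurable]: "(\<lambda>x. K x y) \<in> borel_measurable M"
      using measurable_compose[OF measurable_Pair2'[OF y] K] by simp
    have "(\<integral>\<^sup>+ x. ennreal (K x y * cmod (g y)) \<partial>M) = (\<integral>\<^sup>+ x. ennreal (K x y) \<partial>M) * ennreal (cmod (g y))"
      using pos by (simp add: ennreal_mult' nn_integral_multc)
    also have "\<dots> \<le> ennreal C * ennreal (cmod (g y))"
      using le[OF y] by (rule mult_right_mono) simp
    finally show "(\<integral>\<^sup>+ x. ennreal (K x y * cmod (g y)) \<partial>M) \<le> \<dots>" .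
  qed
  also have "\<dots> = ennreal C * (\<integral>\<^sup>+ y. ennreal (cmod (g y)) \<partial>M)"
    by (rule nn_integral_cmult) measurable
  finally have *: "(\<integral>\<^sup>+ x. kernel_op M K g x \<partial>M) \<le> ennreal C * (\<integral>\<^sup>+ y. ennreal (cmod (g y)) \<partial>M)" .
  have "(\<integral>\<^sup>+ y. ennreal (cmod (g y)) \<partial>M) < \<infinity>"
    using g by (simp add: Lp_finite_iff)
  with * have "(\<integral>\<^sup>+ x. kernel_op M K g x \<partial>M) < \<infinity>"
    by (auto simp: ennreal_mult_less_top intro: le_less_trans)
  then show "AE x in M. kernel_op M K g x < \<infinity>"
    using nn_integral_PInf_AE[OF m] by (auto simp: less_top)
  have "(\<integral>\<^sup>+ x. ennreal (enn2real (kernel_op M K g x) powr enn2real 1) \<partial>M) \<le> (\<integral>\<^sup>+ x. kernel_op M K g x \<partial>M)"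
    by (rule nn_integral_mono) (auto simp: ennreal_enn2real_if)
  with * show "(\<integral>\<^sup>+ x. ennreal (enn2real (kernel_op M K g x) powr enn2real 1) \<partial>M)
      \<le> ennreal C * (\<integral>\<^sup>+ x. ennreal (cmod (g x) powr enn2real 1) \<partial>M)"
    by simp
qed simp_all

text \<open>
  Schur's test with one weight \<open>w\<close>. Split \<open>K \<bar>g\<bar>\<close> as \<open>(K powr (1/q) w) (K powr (1/P) \<bar>g\<bar> / w)\<close> and apply
  Hoelder's inequality in \<open>y\<close>: the row bound controls the first factor. The remaining integral
  \<open>B x\<close> of \<open>K x y (\<bar>g y\<bar> / w y) powr P\<close> enters with the factor \<open>w x powr P\<close>, and
  integrating in \<open>x\<close> first, the column bound turns it into \<open>w y powr P\<close>, which cancels the weight.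
\<close>

lemma Schur_test:
  fixes P q C :: real
  assumes P: "1 < P" "1 < q" "1 / q + 1 / P = 1"
    and M: "sigma_finite_measure M" and K: "case_prod K \<in> borel_measurable (M \<Otimes>\<^sub>M M)"
    and pos: "\<And>x y. 0 \<le> K x y" and C: "0 \<le> C"
    and w: "w \<in> borel_measurable M" "\<And>x. 0 \<le> w x" "AE x in M. 0 < w x"
    and row: "\<And>x. x \<in> space M \<Longrightarrow>
      (\<integral>\<^sup>+ y. ennreal (K x y * w y powr q) \<partial>M) \<le> ennreal (C * w x powr q)"
    and column: "\<And>y. y \<in> space M \<Longrightarrow>
      (\<integral>\<^sup>+ x. ennreal (K x y * w x powr P) \<partial>M) \<le> ennreal (C * w y powr P)"
  shows "Lp_bounded_kernel (ennreal P) M K"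
proof (rule Lp_bounded_kernel_finiteI[OF _ _ M K, of _ "C powr (P / q) * C"])
  interpret pair_sigma_finite M M using M by (simp add: pair_sigma_finite_def)
  show "1 \<le> ennreal P" using P by simp
  show "ennreal P \<noteq> \<infinity>" by simp
  show "0 \<le> C powr (P / q) * C" using C by simp
  fix g assume g: "g \<in> Lp_space (ennreal P) M"
  note [measurable] = K Lp_space_measurable[OF g] w(1)
  have m [measurable]: "kernel_op M K g \<in> borel_measurable M"
    using kernel_op_measurable[OF M K Lp_space_measurable[OF g]] .
  define B where "B x = (\<integral>\<^sup>+ y. ennreal (K x y * (cmod (g y) / w y) powr P) \<partial>M)" for x
  have Bm [measurable]: "B \<in> borel_measurable M"
  proof -
    have "(\<lambda>(x, y). ennreal (K x y * (cmod (g y) / w y) powr P)) \<in> borel_measurable (M \<Otimes>\<^sub>M M)"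
      by measurable
    then show ?thesis unfolding B_def by measurable
  qed
  have Kx: "K x \<in> borel_measurable M" if "x \<in> space M" for x
    using measurable_compose[OF measurable_Pair1'[OF that] K] by simp
  have Ky: "(\<lambda>x. K x y) \<in> borel_measurable M" if "y \<in> space M" for y
    using measurable_compose[OF measurable_Pair2'[OF that] K] by simp
  have gP: "(\<integral>\<^sup>+ y. ennreal (cmod (g y) powr P) \<partial>M) < \<infinity>"
    using g P by (simp add: Lp_finite_iff)
  have op_le: "kernel_op M K g x \<le> ennreal ((C * w x powr q) powr (1 / q) * b powr (1 / P))"
    if x: "x \<in> space M" and b: "B x = ennreal b" "0 \<le> b" for x b
  proof -
    note [measurable] = Kx[OF x]
    have "kernel_op M K g x
        = (\<integral>\<^sup>+ y. ennreal ((K x y powr (1 / q) * w y) * (K x y powr (1 / P) * (cmod (g y) / w y))) \<partial>M)"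
      unfolding kernel_op_def
    proof (rule nn_integral_cong_AE)
      show "AE y in M. ennreal (K x y * cmod (g y))
          = ennreal ((K x y powr (1 / q) * w y) * (K x y powr (1 / P) * (cmod (g y) / w y)))"
        using w(3)
      proof eventually_elim
        case (elim y)
        have "K x y = K x y powr (1 / q) * K x y powr (1 / P)"
          using P pos[of x y] by (simp flip: powr_add)
        moreover have "(K x y powr (1 / q) * w y) * (K x y powr (1 / P) * (cmod (g y) / w y))
            = (K x y powr (1 / q) * K x y powr (1 / P)) * cmod (g y)"
          using elim by simp
        ultimately show ?case by metis
      qed
    qed
    also have "\<dots> \<le> ennreal ((C * w x powr q) powr (1 / q) * b powr (1 / P))"
    proof (rule nn_integral_Holder[OF P(2,1,3)])
      show "(\<integral>\<^sup>+ y. ennreal ((K x y powr (1 / q) * w y) powr q) \<partial>M) \<le> ennreal (C * w x powr q)"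
        using row[OF x] P pos w by (simp add: powr_mult powr_powr)
      show "(\<integral>\<^sup>+ y. ennreal ((K x y powr (1 / P) * (cmod (g y) / w y)) powr P) \<partial>M) \<le> ennreal b"
        using b(1) P pos w unfolding B_def by (subst powr_mult) (auto simp: powr_powr)
    qed (use w C b in auto)
    finally show ?thesis .
  qed
  have wB: "(\<integral>\<^sup>+ x. ennreal (w x powr P) * B x \<partial>M) \<le> ennreal C * (\<integral>\<^sup>+ y. ennreal (cmod (g y) powr P) \<partial>M)"
  proof -
    have "(\<integral>\<^sup>+ x. ennreal (w x powr P) * B x \<partial>M)
        = (\<integral>\<^sup>+ x. (\<integral>\<^sup>+ y. ennreal (w x powr P) * ennreal (K x y * (cmod (g y) / w y) powr P) \<partial>M) \<partial>M)"
      unfolding B_def using Kx by (intro nn_integral_cong nn_integral_cmult[symmetric]) measurable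
    also have "\<dots> = (\<integral>\<^sup>+ y. (\<integral>\<^sup>+ x. ennreal (w x powr P) * ennreal (K x y * (cmod (g y) / w y) powr P) \<partial>M) \<partial>M)"
      by (rule Fubini'[symmetric]) measurable
    also have "\<dots> \<le> (\<integral>\<^sup>+ y. ennreal C * ennreal (cmod (g y) powr P) \<partial>M)"
    proof (rule nn_integral_mono)
      fix y assume y: "y \<in> space M"
      note [measurable] = Ky[OF y]
      have "(\<integral>\<^sup>+ x. ennreal (w x powr P) * ennreal (K x y * (cmod (g y) / w y) powr P) \<partial>M)
         = (\<integral>\<^sup>+ x. ennreal (K x y * w x powr P) * ennreal ((cmod (g y) / w y) powr P) \<partial>M)"
        using pos by (intro nn_integral_cong) (simp add: mult_ac flip: ennreal_mult')
      also have "\<dots> = (\<integral>\<^sup>+ x. ennreal (K x y * w x powr P) \<partial>M) * ennreal ((cmod (g y) / w y) powr P)"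
        by (rule nn_integral_multc) measurable
      also have "\<dots> \<le> ennreal (C * w y powr P) * ennreal ((cmod (g y) / w y) powr P)"
        using column[OF y] by (rule mult_right_mono) simp
      also have "\<dots> = ennreal (C * (w y powr P * (cmod (g y) / w y) powr P))"
        using C by (simp add: mult.assoc flip: ennreal_mult')
      also have "\<dots> \<le> ennreal (C * cmod (g y) powr P)"
      proof (rule ennreal_leI, rule mult_left_mono[OF _ C])
        show "w y powr P * (cmod (g y) / w y) powr P \<le> cmod (g y) powr P"
          using w(2)[of y] P by (cases "w y = 0") (auto simp: powr_divide)
      qed
      finally show "(\<integral>\<^sup>+ x. ennreal (w x powr P) * ennreal (K x y * (cmod (g y) / w y) powr P) \<partial>M)
         \<le> ennreal C * ennreal (cmod (g y) powr P)"
        using C by (simp add: ennreal_mult')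
    qed
    also have "\<dots> = ennreal C * (\<integral>\<^sup>+ y. ennreal (cmod (g y) powr P) \<partial>M)"
      by (rule nn_integral_cmult) measurable
    finally show ?thesis .
  qed
  then have "(\<integral>\<^sup>+ x. ennreal (w x powr P) * B x \<partial>M) < \<infinity>"
    using gP by (auto simp: ennreal_mult_less_top intro: le_less_trans)
  then have "AE x in M. ennreal (w x powr P) * B x \<noteq> \<infinity>"
    by (intro nn_integral_PInf_AE) auto
  then have Bfin: "AE x in M. B x < \<infinity>"
    using w(3) by eventually_elim (auto simp: ennreal_mult_eq_top_iff less_top)
  \<comment> \<open>Where \<open>B x\<close> is finite, the row estimate \<open>op_le\<close> shows that the operator is finite too.\<close>
  show "AE x in M. kernel_op M K g x < \<infinity>"
    using Bfin AE_space
  proof eventually_elim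
    case (elim x)
    then obtain b where "B x = ennreal b" "0 \<le> b" by (cases "B x") auto
    with op_le[OF elim(2)] show ?case by (auto intro: le_less_trans)
  qed
  have "(\<integral>\<^sup>+ x. ennreal (enn2real (kernel_op M K g x) powr P) \<partial>M)
      \<le> (\<integral>\<^sup>+ x. ennreal (C powr (P / q)) * (ennreal (w x powr P) * B x) \<partial>M)"
  proof (rule nn_integral_mono_AE)
    show "AE x in M. ennreal (enn2real (kernel_op M K g x) powr P)
        \<le> ennreal (C powr (P / q)) * (ennreal (w x powr P) * B x)"
      using Bfin AE_space
    proof eventually_elim
      case (elim x)
      then obtain b where b: "B x = ennreal b" "0 \<le> b" by (cases "B x") auto
      have "enn2real (kernel_op M K g x) \<le> (C * w x powr q) powr (1 / q) * b powr (1 / P)"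
        using enn2real_mono[OF op_le[OF elim(2) b]] C by simp
      then have "enn2real (kernel_op M K g x) powr P
          \<le> ((C * w x powr q) powr (1 / q) * b powr (1 / P)) powr P"
        using P by (intro powr_mono2) auto
      also have "\<dots> = C powr (P / q) * (w x powr P * b)"
        using P C w(2)[of x] b by (simp add: powr_mult powr_powr)
      finally show ?case
        using b C by (simp flip: ennreal_mult')
    qed
  qed
  also have "\<dots> = ennreal (C powr (P / q)) * (\<integral>\<^sup>+ x. ennreal (w x powr P) * B x \<partial>M)"
    by (rule nn_integral_cmult) measurable
  also have "\<dots> \<le> ennreal (C powr (P / q)) * (ennreal C * (\<integral>\<^sup>+ y. ennreal (cmod (g y) powr P) \<partial>M))"
    using wB by (rule mult_left_mono) simp
  finally show "(\<integral>\<^sup>+ x. ennreal (enn2real (kernel_op M K g x) powr enn2real (ennreal P)) \<partial>M)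
      \<le> ennreal (C powr (P / q) * C) * (\<integral>\<^sup>+ x. ennreal (cmod (g x) powr enn2real (ennreal P)) \<partial>M)"
    using C P by (simp add: ennreal_mult' mult.assoc)
qed

section \<open>Integration over dyadic shells\<close>

text \<open>
  On the annulus \<open>2\<^sup>-\<^sup>n\<^sup>-\<^sup>1 < \<bar>z\<bar> \<le> 2\<^sup>-\<^sup>n\<close> every power of \<open>\<bar>z\<bar>\<close> is constant up to a bounded factor, and its area
  is a constant times \<open>4\<^sup>-\<^sup>n\<close>. Integrals of functions of \<open>\<bar>z\<bar>\<close> over the punctured unit disc therefore
  converge or diverge together with series, without passing to polar coordinates.
\<close>

definition dyadic_shell :: "nat \<Rightarrow> complex set" where
  "dyadic_shell n = {z. (1/2) ^ Suc n < cmod z \<and> cmod z \<le> (1/2) ^ n}"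

lemma dyadic_shell_eq: "dyadic_shell n = cball 0 ((1/2) ^ n) - cball 0 ((1/2) ^ Suc n)"
  by (auto simp: dyadic_shell_def)

lemma dyadic_shell_borel [measurable]: "dyadic_shell n \<in> sets borel"
  by (simp add: dyadic_shell_eq)

lemma emeasure_dyadic_shell: "emeasure lborel (dyadic_shell n) = ennreal (3 * pi / 4 * (1/4) ^ n)"
proof -
  have sub: "cball (0::complex) ((1/2) ^ Suc n) \<subseteq> cball 0 ((1/2) ^ n)"
    by (intro subset_cball power_decreasing) auto
  have "emeasure lborel (dyadic_shell n)
      = emeasure lborel (cball (0::complex) ((1/2) ^ n)) - emeasure lborel (cball (0::complex) ((1/2) ^ Suc n))"
    unfolding dyadic_shell_eq by (rule emeasure_Diff) (use sub in \<open>auto simp: emeasure_cball\<close>)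
  also have "\<dots> = ennreal (pi * ((1/2) ^ n)\<^sup>2) - ennreal (pi * ((1/2) ^ Suc n)\<^sup>2)"
    by (subst (1 2) emeasure_cball) (simp_all add: unit_ball_vol_2)
  also have "\<dots> = ennreal (pi * ((1/2) ^ n)\<^sup>2 - pi * ((1/2) ^ Suc n)\<^sup>2)"
    by (rule ennreal_minus) simp
  also have "pi * ((1/2) ^ n)\<^sup>2 - pi * ((1/2) ^ Suc n)\<^sup>2 = 3 * pi / 4 * (1/4) ^ n"
  proof -
    have "((1/2::real) ^ n)\<^sup>2 = (1/4) ^ n"
    proof -
      have "((1/2::real) ^ n)\<^sup>2 = ((1/2)\<^sup>2) ^ n"
        by (simp only: power_mult[symmetric] mult.commute)
      then show ?thesis by (simp add: power2_eq_square)
    qed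
    moreover have "((1/2::real) ^ Suc n)\<^sup>2 = ((1/2) ^ n)\<^sup>2 / 4"
      by (simp only: power_Suc power_mult_distrib) (simp add: power2_eq_square)
    ultimately show ?thesis by simp
  qed
  finally show ?thesis .
qed

lemma dyadic_shell_disjoint: "disjoint_family dyadic_shell"
proof -
  have "m = n" if "z \<in> dyadic_shell m" "z \<in> dyadic_shell n" for z m n
  proof (rule ccontr)
    have *: False if "z \<in> dyadic_shell i" "z \<in> dyadic_shell j" "i < j" for i j
      using that power_decreasing[of "Suc i" j "1/2::real"] by (simp add: dyadic_shell_def)
    assume "m \<noteq> n"
    then show False using that *[of m n] *[of n m] by force
  qed
  then show ?thesis by (auto simp: disjoint_family_on_def)
qed

lemma dyadic_shell_exists:
  assumes "z \<noteq> 0" "cmod z \<le> 1"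
  obtains n where "z \<in> dyadic_shell n"
proof -
  have "\<exists>n. (1/2) ^ Suc n < cmod z"
  proof -
    obtain n where "(1/2::real) ^ n < cmod z"
      using real_arch_pow_inv[of "cmod z" "1/2"] assms by auto
    then have "(1/2::real) ^ Suc n < cmod z"
      using power_decreasing[of n "Suc n" "1/2::real"] by (rule_tac le_less_trans) auto
    then show ?thesis ..
  qed
  then obtain N where N: "(1/2) ^ Suc N < cmod z" by blast
  define n where "n = (LEAST n. (1/2) ^ Suc n < cmod z)"
  have 1: "(1/2) ^ Suc n < cmod z" unfolding n_def using N by (rule LeastI)
  have 2: "cmod z \<le> (1/2) ^ n"
  proof (cases n)
    case (Suc m)
    have "\<not> (1/2) ^ Suc m < cmod z"
      using not_less_Least[of m "\<lambda>n. (1/2) ^ Suc n < cmod z"] Suc by (simp add: n_def)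
    then show ?thesis using Suc by simp
  qed (use assms in simp)
  from 1 2 show ?thesis by (intro that[of n]) (simp add: dyadic_shell_def)
qed

lemma nn_integral_dyadic_shells:
  assumes [measurable]: "F \<in> borel_measurable borel" and F: "\<And>z. z = 0 \<or> 1 < cmod z \<Longrightarrow> F z = 0"
  shows "(\<integral>\<^sup>+ z. F z \<partial>lborel) = (\<Sum>n. \<integral>\<^sup>+ z. F z * indicator (dyadic_shell n) z \<partial>lborel)"
proof -
  have split: "F z = (\<Sum>n. F z * indicator (dyadic_shell n) z)" for z
  proof (cases "z = 0 \<or> 1 < cmod z")
    case False
    then have "z \<noteq> 0" "cmod z \<le> 1" by auto
    then obtain n where "z \<in> dyadic_shell n" by (rule dyadic_shell_exists)
    then show ?thesis
      using suminf_cmult_indicator[OF dyadic_shell_disjoint, of z n "\<lambda>_. F z"] by simp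
  qed (simp add: F)
  have "(\<integral>\<^sup>+ z. F z \<partial>lborel) = (\<integral>\<^sup>+ z. (\<Sum>n. F z * indicator (dyadic_shell n) z) \<partial>lborel)"
    by (rule nn_integral_cong) (rule split)
  also have "\<dots> = (\<Sum>n. \<integral>\<^sup>+ z. F z * indicator (dyadic_shell n) z \<partial>lborel)"
    by (rule nn_integral_suminf) measurable
  finally show ?thesis .
qed

lemma nn_integral_dyadic_le:
  assumes F: "F \<in> borel_measurable borel" "\<And>z. z = 0 \<or> 1 < cmod z \<Longrightarrow> F z = 0"
    and le: "\<And>n z. z \<in> dyadic_shell n \<Longrightarrow> F z \<le> ennreal (a n)" and a: "\<And>n. 0 \<le> a n"
    and sum: "summable (\<lambda>n. a n * (1/4) ^ n)"
  shows "(\<integral>\<^sup>+ z. F z \<partial>lborel) < \<infinity>"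
proof -
  have "(\<integral>\<^sup>+ z. F z \<partial>lborel) = (\<Sum>n. \<integral>\<^sup>+ z. F z * indicator (dyadic_shell n) z \<partial>lborel)"
    by (rule nn_integral_dyadic_shells[OF F])
  also have "\<dots> \<le> (\<Sum>n. ennreal (3 * pi / 4 * (a n * (1/4) ^ n)))"
  proof (rule suminf_le[OF _ summableI summableI])
    fix n
    have "(\<integral>\<^sup>+ z. F z * indicator (dyadic_shell n) z \<partial>lborel)
        \<le> (\<integral>\<^sup>+ z. ennreal (a n) * indicator (dyadic_shell n) z \<partial>lborel)"
      by (rule nn_integral_mono) (auto simp: indicator_def le)
    also have "\<dots> = ennreal (3 * pi / 4 * (a n * (1/4) ^ n))"
      using a[of n] by (simp add: nn_integral_cmult_indicator emeasure_dyadic_shell mult_ac flip: ennreal_mult')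
    finally show "(\<integral>\<^sup>+ z. F z * indicator (dyadic_shell n) z \<partial>lborel) \<le> \<dots>" .
  qed
  also have "\<dots> < \<infinity>"
    using summable_mult[OF sum, of "3 * pi / 4"] a by (subst suminf_ennreal2) auto
  finally show ?thesis .
qed

lemma nn_integral_dyadic_ge:
  assumes F: "F \<in> borel_measurable borel" "\<And>z. z = 0 \<or> 1 < cmod z \<Longrightarrow> F z = 0"
    and ge: "\<And>n z. z \<in> dyadic_shell n \<Longrightarrow> ennreal (a n) \<le> F z" and a: "\<And>n. 0 \<le> a n"
    and sum: "\<not> summable (\<lambda>n. a n * (1/4) ^ n)"
  shows "(\<integral>\<^sup>+ z. F z \<partial>lborel) = \<infinity>"
proof -
  have "(\<Sum>n. ennreal (3 * pi / 4 * (a n * (1/4) ^ n))) = \<infinity>"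
  proof (rule ccontr)
    assume "(\<Sum>n. ennreal (3 * pi / 4 * (a n * (1/4) ^ n))) \<noteq> \<infinity>"
    then have "summable (\<lambda>n. 3 * pi / 4 * (a n * (1/4) ^ n))"
      using a by (intro summable_suminf_not_top) auto
    then show False using sum summable_mult_D[of "3 * pi / 4"] by fastforce
  qed
  moreover have "(\<Sum>n. ennreal (3 * pi / 4 * (a n * (1/4) ^ n)))
      \<le> (\<Sum>n. \<integral>\<^sup>+ z. F z * indicator (dyadic_shell n) z \<partial>lborel)"
  proof (rule suminf_le[OF _ summableI summableI])
    fix n
    have "ennreal (3 * pi / 4 * (a n * (1/4) ^ n))
        = (\<integral>\<^sup>+ z. ennreal (a n) * indicator (dyadic_shell n) z \<partial>lborel)"
      using a[of n] by (simp add: nn_integral_cmult_indicator emeasure_dyadic_shell mult_ac flip: ennreal_mult')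
    also have "\<dots> \<le> (\<integral>\<^sup>+ z. F z * indicator (dyadic_shell n) z \<partial>lborel)"
      by (rule nn_integral_mono) (auto simp: indicator_def ge)
    finally show "ennreal (3 * pi / 4 * (a n * (1/4) ^ n)) \<le> \<dots>" .
  qed
  ultimately show ?thesis
    using nn_integral_dyadic_shells[OF F] by (simp add: top_unique)
qed

lemma half_power_powr: "((1/2) ^ n) powr (c::real) = (2 powr (- c)) ^ n"
proof -
  have "((1/2) ^ n) powr c = ((2::real) powr (- real n)) powr c"
    by (simp add: powr_minus powr_realpow power_one_over inverse_eq_divide)
  also have "\<dots> = (2 powr (- c)) powr real n"
    by (simp add: powr_powr mult.commute)
  finally show ?thesis by (simp add: powr_realpow)
qed

section \<open>Integrals of homogeneous kernels\<close>

text \<open>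
  Near the origin, the shell of index \<open>n\<close> contributes at most a constant times
  \<open>2\<^sup>-\<^sup>n\<^sup>c \<cdot> 4\<^sup>-\<^sup>n\<close>, which is geometric with ratio below \<open>1\<close> because \<open>c > -2\<close>.
  Outside the unit disc the integrand is bounded on the ball.
\<close>

lemma nn_integral_powr_ball_finite:
  assumes c: "-2 < c" and R: "0 < R"
  shows "(\<integral>\<^sup>+ z. ennreal (cmod z powr c) * indicator (ball 0 R) z \<partial>lborel) < \<infinity>"
proof -
  have [measurable]: "cball (0::complex) 1 \<in> sets borel" "ball (0::complex) R \<in> sets borel"
    by simp_all
  define F where "F z = ennreal (cmod z powr c) * indicator (cball 0 1) z" for z
  have F: "(\<integral>\<^sup>+ z. F z \<partial>lborel) < \<infinity>"
  proof (rule nn_integral_dyadic_le)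
    show "F \<in> borel_measurable borel" unfolding F_def by measurable
    show "F z = 0" if "z = 0 \<or> 1 < cmod z" for z
      using that by (auto simp: F_def)
    show "F z \<le> ennreal (2 powr \<bar>c\<bar> * (2 powr (- c)) ^ n)" if z: "z \<in> dyadic_shell n" for z n
    proof -
      have "cmod z powr c \<le> 2 powr \<bar>c\<bar> * ((1/2) ^ n) powr c"
      proof (cases "0 \<le> c")
        case True
        then have "cmod z powr c \<le> ((1/2) ^ n) powr c"
          using z by (intro powr_mono2) (auto simp: dyadic_shell_def)
        also have "\<dots> \<le> 2 powr \<bar>c\<bar> * ((1/2) ^ n) powr c"
          using ge_one_powr_ge_zero[of 2 "\<bar>c\<bar>"] by (simp add: mult_le_cancel_right1)
        finally show ?thesis .
      next
        case False
        then have "cmod z powr c \<le> ((1/2) * (1/2) ^ n) powr c"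
          using z by (intro powr_mono2') (auto simp: dyadic_shell_def)
        also have "\<dots> = (1/2) powr c * ((1/2) ^ n) powr c"
          by (rule powr_mult)
        also have "(1/2) powr c = 2 powr \<bar>c\<bar>"
          using False by (simp add: powr_divide powr_minus_divide)
        finally show ?thesis .
      qed
      then show ?thesis
        unfolding half_power_powr by (auto simp: F_def indicator_def ennreal_leI)
    qed
    have "2 powr (- c) * (1/4) < (1::real)"
      using c powr_less_mono[of "-c" 2 2] by simp
    then have "summable (\<lambda>n. 2 powr \<bar>c\<bar> * (2 powr (- c) * (1/4)) ^ n)"
      by (intro summable_mult summable_geometric) simp
    then show "summable (\<lambda>n. 2 powr \<bar>c\<bar> * (2 powr (- c)) ^ n * (1/4) ^ n)"
      by (simp only: power_mult_distrib mult.assoc)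
  qed simp_all
  have "ennreal (cmod z powr c) * indicator (ball 0 R) z
      \<le> F z + ennreal (max 1 (R powr c)) * indicator (ball 0 R) z" for z
  proof (cases "1 < cmod z \<and> cmod z < R")
    case True
    have "cmod z powr c \<le> max 1 (R powr c)"
    proof (cases "0 \<le> c")
      case c: True
      with True have "cmod z powr c \<le> R powr c" by (intro powr_mono2) auto
      then show ?thesis by simp
    next
      case False
      with True have "cmod z powr c \<le> 1 powr c" by (intro powr_mono2') auto
      then show ?thesis by simp
    qed
    then show ?thesis using True by (auto simp: F_def ennreal_leI)
  next
    case False
    then show ?thesis by (auto simp: F_def indicator_def)
  qed
  then have "(\<integral>\<^sup>+ z. ennreal (cmod z powr c) * indicator (ball 0 R) z \<partial>lborel)
      \<le> (\<integral>\<^sup>+ z. F z + ennreal (max 1 (R powr c)) * indicator (ball 0 R) z \<partial>lborel)"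
    by (intro nn_integral_mono)
  also have "\<dots> = (\<integral>\<^sup>+ z. F z \<partial>lborel) + ennreal (max 1 (R powr c)) * emeasure lborel (ball (0::complex) R)"
    unfolding F_def by (simp add: nn_integral_add nn_integral_cmult_indicator)
  also have "\<dots> < \<infinity>"
    using F R by (simp add: emeasure_ball flip: ennreal_mult')
  finally show ?thesis .
qed

lemma borel_measurable_lebesgue_onI:
  "f \<in> borel_measurable borel \<Longrightarrow> f \<in> borel_measurable (lebesgue_on D)"
  by (simp add: measurable_completion measurable_restrict_space1)

text \<open>
  The bound is uniform in the centre \<open>z\<close>: translated by \<open>z\<close>, the set \<open>D\<close> stays in \<open>ball 0 (2 * R)\<close>.
\<close>

lemma nn_integral_lebesgue_on_powr_le:
  fixes D :: "complex set"
  assumes c: "-2 < c" and D: "D \<in> sets lebesgue" "D \<subseteq> ball 0 R" and R: "0 < R"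
  obtains C where "0 \<le> C"
    "\<And>z. z \<in> ball 0 R \<Longrightarrow> (\<integral>\<^sup>+ y. ennreal (cmod (y - z) powr c) \<partial>lebesgue_on D) \<le> ennreal C"
proof
  define I where "I = (\<integral>\<^sup>+ z. ennreal (cmod z powr c) * indicator (ball 0 (2 * R)) z \<partial>lborel)"
  have I: "I < \<infinity>" unfolding I_def using c R by (intro nn_integral_powr_ball_finite) auto
  show "0 \<le> enn2real I" by simp
  fix z :: complex assume z: "z \<in> ball 0 R"
  have "(\<integral>\<^sup>+ y. ennreal (cmod (y - z) powr c) \<partial>lebesgue_on D)
      = (\<integral>\<^sup>+ y. ennreal (cmod (y - z) powr c) * indicator D y \<partial>lebesgue)"
    using D by (intro nn_integral_restrict_space) auto
  also have "\<dots> \<le> (\<integral>\<^sup>+ y. ennreal (cmod (y - z) powr c) * indicator (ball 0 (2 * R)) (y - z) \<partial>lebesgue)"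
  proof (intro nn_integral_mono mult_left_mono)
    fix y
    show "indicator D y \<le> (indicator (ball 0 (2 * R)) (y - z) :: ennreal)"
      using D z norm_triangle_ineq4[of y z] by (auto simp: indicator_def)
  qed simp
  also have "\<dots> = (\<integral>\<^sup>+ y. ennreal (cmod (y - z) powr c) * indicator (ball 0 (2 * R)) (y - z) \<partial>lborel)"
    by (rule nn_integral_completion)
  also have "\<dots> = (\<integral>\<^sup>+ y. ennreal (cmod (y - z) powr c) * indicator (ball 0 (2 * R)) (y - z) \<partial>distr lborel borel ((+) z))"
    by (simp add: lborel_distr_plus)
  also have "\<dots> = I"
  proof -
    have [measurable]: "ball (0::complex) (2 * R) \<in> sets borel" by simp
    show ?thesis
      unfolding I_def by (subst nn_integral_distr) simp_all
  qed
  finally show "(\<integral>\<^sup>+ y. ennreal (cmod (y - z) powr c) \<partial>lebesgue_on D) \<le> ennreal (enn2real I)"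
    using I by simp
qed

text \<open>
  For \<open>u = \<bar>y\<bar>\<close>, \<open>v = \<bar>y - z\<bar>\<close> and \<open>r = \<bar>z\<bar>\<close> both sides are homogeneous of degree \<open>a - 1\<close>, so only the
  singular regimes \<open>u \<rightarrow> 0\<close> and \<open>v \<rightarrow> 0\<close> and the growth at infinity matter. Since \<open>r \<le> 2 max u v\<close> and the
  exponent \<open>b = a + 1 - e\<close> of \<open>r\<close> is not positive, \<open>r powr b\<close> may be replaced by the power of the larger
  one of \<open>u\<close> and \<open>v\<close>; what is left compares powers of \<open>u\<close> and \<open>v\<close>. The point is that \<open>e - 2 > -2\<close>:
  the loss of \<open>e\<close> in the exponent buys right-hand terms that are locally integrable in \<open>y\<close>, so the
  integral of the kernel can be bounded without cutting the domain into pieces.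
\<close>

lemma homogeneous_kernel_le:
  fixes u v r a e :: real
  assumes "0 \<le> u" "0 \<le> v" "0 < r" "r \<le> u + v"
    and e: "0 < e" "e \<le> 1" and b: "-1 \<le> a + 1 - e" "a + 1 - e \<le> 0"
  shows "u powr a / v \<le> 2 * r powr (a + 1 - e) * (u powr (e - 2) + v powr (e - 2))"
proof (cases "u = 0 \<or> v = 0")
  case False
  then have uv: "0 < u" "0 < v" using assms by auto
  define b where "b = a + 1 - e"
  have m: "x powr b \<le> 2 * r powr b" if "r \<le> 2 * x" "0 < x" for x
  proof -
    have "x powr b = 2 powr (- b) * (2 * x) powr b"
      using that by (simp add: powr_mult flip: powr_add)
    also have "\<dots> \<le> 2 powr 1 * r powr b"
      using that assms b by (intro mult_mono powr_mono powr_mono2') (auto simp: b_def)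
    finally show ?thesis by simp
  qed
  show ?thesis
  proof (cases "u \<le> v")
    case True
    have "u powr a / v = u powr (e - 2) * u powr (b + 1) / v"
      using uv by (simp add: b_def flip: powr_add)
    also have "\<dots> \<le> u powr (e - 2) * v powr (b + 1) / v"
      using uv True b by (intro divide_right_mono mult_left_mono powr_mono2) (auto simp: b_def)
    also have "\<dots> = u powr (e - 2) * v powr b"
      using uv by (simp add: powr_add)
    also have "\<dots> \<le> u powr (e - 2) * (2 * r powr b)"
      using m[of v] True assms uv by (intro mult_left_mono) auto
    also have "\<dots> \<le> 2 * r powr b * (u powr (e - 2) + v powr (e - 2))"
      by (simp add: algebra_simps)
    finally show ?thesis by (simp add: b_def)
  next
    case False
    have "u powr a / v = u powr b * u powr (e - 1) / v"
      using uv by (simp add: b_def flip: powr_add)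
    also have "\<dots> \<le> u powr b * v powr (e - 1) / v"
      using uv False e by (intro divide_right_mono mult_left_mono powr_mono2') auto
    also have "\<dots> = u powr b * v powr (e - 2)"
    proof -
      have "v powr (e - 1) = v powr (e - 2) * v"
        using uv powr_add[of v "e - 2" 1] by simp
      then show ?thesis using uv by simp
    qed
    also have "\<dots> \<le> (2 * r powr b) * v powr (e - 2)"
      using m[of u] False assms uv by (intro mult_right_mono) auto
    also have "\<dots> \<le> 2 * r powr b * (u powr (e - 2) + v powr (e - 2))"
      by (simp add: algebra_simps)
    finally show ?thesis by (simp add: b_def)
  qed
qed (use assms in auto)

text \<open>
  The power \<open>\<alpha>\<close> of \<open>\<bar>z\<bar>\<close> is carried inside the integral so that the estimate also holds at \<open>z = 0\<close>,
  where \<open>0 powr \<alpha> = 0\<close> makes both sides vanish.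
\<close>

lemma nn_integral_homogeneous_kernel_le:
  fixes D :: "complex set"
  assumes D: "D \<in> sets lebesgue" "D \<subseteq> ball 0 R" and R: "0 < R"
    and e: "0 < e" "e \<le> 1" and a: "-1 \<le> a + 1 - e" "a + 1 - e \<le> 0"
  obtains C where "0 \<le> C"
    "\<And>z \<alpha>. z \<in> D \<Longrightarrow> (\<integral>\<^sup>+ y. ennreal (cmod z powr \<alpha> * (cmod y powr a / cmod (y - z))) \<partial>lebesgue_on D)
      \<le> ennreal (C * cmod z powr (\<alpha> + a + 1 - e))"
proof -
  have "-2 < e - 2" using e by simp
  from nn_integral_lebesgue_on_powr_le[OF this D R] obtain C where C: "0 \<le> C"
    "\<And>z. z \<in> ball 0 R \<Longrightarrow> (\<integral>\<^sup>+ y. ennreal (cmod (y - z) powr (e - 2)) \<partial>lebesgue_on D) \<le> ennreal C"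
    by blast
  show thesis
  proof (rule that[of "4 * C"])
    show "0 \<le> 4 * C" using C by simp
    fix z :: complex and \<alpha> :: real assume z: "z \<in> D"
    show "(\<integral>\<^sup>+ y. ennreal (cmod z powr \<alpha> * (cmod y powr a / cmod (y - z))) \<partial>lebesgue_on D)
      \<le> ennreal (4 * C * cmod z powr (\<alpha> + a + 1 - e))"
    proof (cases "z = 0")
      case False
      let ?A = "2 * cmod z powr (\<alpha> + a + 1 - e)"
      have m: "(\<lambda>y. ennreal (cmod (y - w) powr (e - 2))) \<in> borel_measurable (lebesgue_on D)" for w
        by (rule borel_measurable_lebesgue_onI) measurable
      have "(\<integral>\<^sup>+ y. ennreal (cmod z powr \<alpha> * (cmod y powr a / cmod (y - z))) \<partial>lebesgue_on D)
        \<le> (\<integral>\<^sup>+ y. ennreal ?A * (ennreal (cmod (y - 0) powr (e - 2)) + ennreal (cmod (y - z) powr (e - 2))) \<partial>lebesgue_on D)"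
      proof (rule nn_integral_mono)
        fix y
        have "cmod z powr \<alpha> * (cmod y powr a / cmod (y - z)) \<le>
           cmod z powr \<alpha> * (2 * cmod z powr (a + 1 - e) * (cmod y powr (e - 2) + cmod (y - z) powr (e - 2)))"
          using False e a norm_triangle_ineq4[of y "y - z"]
          by (intro mult_left_mono homogeneous_kernel_le) auto
        also have "\<dots> = ?A * (cmod y powr (e - 2) + cmod (y - z) powr (e - 2))"
          by (simp add: powr_add powr_diff)
        finally show "ennreal (cmod z powr \<alpha> * (cmod y powr a / cmod (y - z)))
          \<le> ennreal ?A * (ennreal (cmod (y - 0) powr (e - 2)) + ennreal (cmod (y - z) powr (e - 2)))"
          by (simp add: ennreal_leI flip: ennreal_mult' ennreal_plus)
      qed
      also have "\<dots> = ennreal ?A * ((\<integral>\<^sup>+ y. ennreal (cmod (y - 0) powr (e - 2)) \<partial>lebesgue_on D)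
          + (\<integral>\<^sup>+ y. ennreal (cmod (y - z) powr (e - 2)) \<partial>lebesgue_on D))"
        using m[of 0] m[of z] by (simp only: nn_integral_cmult nn_integral_add borel_measurable_add)
      also have "\<dots> \<le> ennreal ?A * (ennreal C + ennreal C)"
        using C(2)[of 0] C(2)[of z] z D R by (intro mult_left_mono add_mono) auto
      also have "\<dots> = ennreal (4 * C * cmod z powr (\<alpha> + a + 1 - e))"
        using C by (simp add: mult_ac flip: ennreal_mult' ennreal_plus)
      finally show ?thesis .
    qed simp
  qed
qed

section \<open>The weight of the Cauchy-Riemann operator\<close>

lemma cmod_unweight: "cmod (unweight t f z) = cmod z powr (- t) * cmod (f z)"
  by (simp add: unweight_def norm_mult)

lemma cmod_unweight_shift: "cmod (unweight t f z) = cmod z powr (s - t) * cmod (unweight s f z)"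
proof -
  have "cmod z powr (- t) = cmod z powr (s - t) * cmod z powr (- s)"
    by (simp flip: powr_add)
  then show ?thesis by (simp add: cmod_unweight)
qed

lemma unweight_measurable:
  assumes f: "f \<in> borel_measurable (lebesgue_on D)"
  shows "unweight t f \<in> borel_measurable (lebesgue_on D)"
proof -
  have "(\<lambda>z. complex_of_real (cmod z powr (- t))) \<in> borel_measurable (lebesgue_on D)"
    by (rule borel_measurable_lebesgue_onI) measurable
  then show ?thesis using f unfolding unweight_def by measurable
qed

text \<open>
  The condition on \<open>\<tau>\<close> says that \<open>\<bar>z\<bar> powr \<tau>\<close> is locally in the dual space: bounded for \<open>p = 1\<close>, and
  \<open>q\<close>-integrable for the conjugate exponent \<open>q\<close> otherwise, as \<open>- 2 / q = - (2 - 2 / p)\<close>. For \<open>p = \<infinity>\<close>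
  the conventions \<open>enn2real \<infinity> = 0\<close> and \<open>2 / 0 = 0\<close> make \<open>2 - 2 / enn2real p\<close> the correct value \<open>2\<close>;
  the same expression is used for all exponents below.
\<close>

lemma nn_integral_weight_finite:
  fixes D :: "complex set"
  assumes D: "D \<in> sets lebesgue" "bounded D" and p: "1 \<le> p" and g: "g \<in> Lp_space p (lebesgue_on D)"
    and \<tau>: "if p = 1 then 0 \<le> \<tau> else - (2 - 2 / enn2real p) < \<tau>"
  shows "(\<integral>\<^sup>+ z. ennreal (cmod z powr \<tau> * cmod (g z)) \<partial>lebesgue_on D) < \<infinity>"
proof -
  let ?M = "lebesgue_on D"
  obtain R where R: "0 < R" "D \<subseteq> ball 0 R"
    using bounded_subset_ballD[OF D(2)] by blast
  have fin: "(\<integral>\<^sup>+ z. ennreal (cmod z powr c) \<partial>?M) < \<infinity>" if "-2 < c" for c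
  proof -
    obtain C where "\<And>z. z \<in> ball 0 R \<Longrightarrow> (\<integral>\<^sup>+ y. ennreal (cmod (y - z) powr c) \<partial>?M) \<le> ennreal C"
      using nn_integral_lebesgue_on_powr_le[OF \<open>-2 < c\<close> D(1) R(2,1)] by blast
    from this[of 0] show ?thesis using R by (auto intro: le_less_trans)
  qed
  have wm: "(\<lambda>z. ennreal (cmod z powr c)) \<in> borel_measurable ?M" for c
    by (rule borel_measurable_lebesgue_onI) measurable
  note [measurable] = Lp_space_measurable[OF g]
  consider "p = 1" | "p = \<infinity>" | "p \<noteq> 1" "p \<noteq> \<infinity>" by blast
  then show ?thesis
  proof cases
    case 1
    have "(\<integral>\<^sup>+ z. ennreal (cmod z powr \<tau> * cmod (g z)) \<partial>?M)
        \<le> (\<integral>\<^sup>+ z. ennreal (R powr \<tau>) * ennreal (cmod (g z)) \<partial>?M)"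
    proof (rule nn_integral_mono)
      fix z assume "z \<in> space ?M"
      then have "cmod z powr \<tau> \<le> R powr \<tau>"
        using R 1 \<tau> by (intro powr_mono2) auto
      then show "ennreal (cmod z powr \<tau> * cmod (g z)) \<le> ennreal (R powr \<tau>) * ennreal (cmod (g z))"
        by (auto intro!: ennreal_leI mult_right_mono simp flip: ennreal_mult')
    qed
    also have "\<dots> = ennreal (R powr \<tau>) * (\<integral>\<^sup>+ z. ennreal (cmod (g z)) \<partial>?M)"
      by (rule nn_integral_cmult) measurable
    also have "\<dots> < \<infinity>"
      using g 1 by (simp add: Lp_finite_iff ennreal_mult_less_top)
    finally show ?thesis .
  next
    case 2
    have "(\<integral>\<^sup>+ z. ennreal (cmod z powr \<tau> * cmod (g z)) \<partial>?M)
        \<le> (\<integral>\<^sup>+ z. ennreal (cmod z powr \<tau>) * ennreal (Lp_norm \<infinity> ?M g) \<partial>?M)"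
    proof (rule nn_integral_mono_AE)
      show "AE z in ?M. ennreal (cmod z powr \<tau> * cmod (g z)) \<le> ennreal (cmod z powr \<tau>) * ennreal (Lp_norm \<infinity> ?M g)"
        using Lp_top_AE[OF g[unfolded 2]]
        by eventually_elim
          (auto intro!: ennreal_leI mult_left_mono simp flip: ennreal_mult')
    qed
    also have "\<dots> = (\<integral>\<^sup>+ z. ennreal (cmod z powr \<tau>) \<partial>?M) * ennreal (Lp_norm \<infinity> ?M g)"
      by (rule nn_integral_multc) (rule wm)
    also have "\<dots> < \<infinity>"
      using fin[of \<tau>] \<tau> 2 by (auto simp: ennreal_mult_less_top)
    finally show ?thesis .
  next
    case 3
    define P where "P = enn2real p"
    have "1 < P" using enn2real_gt_one[OF p 3] by (simp add: P_def)
    define q where "q = P / (P - 1)"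
    have q: "1 < q" "1 / q + 1 / P = 1" using \<open>1 < P\<close> by (auto simp: q_def field_simps)
    have "- 2 < \<tau> * q"
      using \<tau> 3 \<open>1 < P\<close> by (simp add: q_def field_simps flip: P_def)
    have "(\<integral>\<^sup>+ z. ennreal (cmod z powr \<tau> * cmod (g z)) \<partial>?M)
        \<le> (\<integral>\<^sup>+ z. ennreal (cmod z powr (\<tau> * q)) + ennreal (cmod (g z) powr P) \<partial>?M)"
    proof (rule nn_integral_mono)
      fix z
      have "cmod z powr \<tau> * cmod (g z) \<le> (cmod z powr \<tau>) powr q / q + cmod (g z) powr P / P"
        using q \<open>1 < P\<close> by (intro Youngs_inequality) auto
      also have "\<dots> \<le> (cmod z powr \<tau>) powr q + cmod (g z) powr P"
        using q \<open>1 < P\<close> by (intro add_mono) (auto simp: divide_le_eq mult_le_cancel_left1)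
      finally show "ennreal (cmod z powr \<tau> * cmod (g z)) \<le> ennreal (cmod z powr (\<tau> * q)) + ennreal (cmod (g z) powr P)"
        by (simp add: powr_powr ennreal_leI flip: ennreal_plus)
    qed
    also have "\<dots> = (\<integral>\<^sup>+ z. ennreal (cmod z powr (\<tau> * q)) \<partial>?M) + (\<integral>\<^sup>+ z. ennreal (cmod (g z) powr P) \<partial>?M)"
      by (rule nn_integral_add) (use wm in measurable)
    also have "\<dots> < \<infinity>"
      using fin[OF \<open>- 2 < \<tau> * q\<close>] g 3 by (simp add: Lp_finite_iff P_def)
    finally show ?thesis .
  qed
qed

text \<open>
  A series rather than a case distinction, so that measurability is immediate; as the shells are
  disjoint, at most one term is nonzero.
\<close>

definition dyadic_step :: "(nat \<Rightarrow> real) \<Rightarrow> complex \<Rightarrow> real" where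
  "dyadic_step c z = (\<Sum>n. c n * indicator (dyadic_shell n) z)"

lemma dyadic_step_measurable [measurable]: "dyadic_step c \<in> borel_measurable borel"
  unfolding dyadic_step_def by measurable

lemma dyadic_step_eq:
  assumes "z \<in> dyadic_shell n"
  shows "dyadic_step c z = c n"
proof -
  have "z \<notin> dyadic_shell m" if "m \<noteq> n" for m
    using dyadic_shell_disjoint assms that by (auto simp: disjoint_family_on_def)
  then have "(\<Sum>m. c m * indicator (dyadic_shell m) z) = (\<Sum>m\<in>{n}. c m * indicator (dyadic_shell m) z)"
    by (intro suminf_finite) auto
  then show ?thesis using assms by (simp add: dyadic_step_def)
qed

lemma dyadic_step_eq_0:
  assumes "z = 0 \<or> 1 < cmod z"
  shows "dyadic_step c z = 0"
proof -
  have "z \<notin> dyadic_shell n" for n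
    using assms power_le_one[of "1/2::real" n] by (auto simp: dyadic_shell_def)
  then show ?thesis by (simp add: dyadic_step_def)
qed

lemma dyadic_step_bounds:
  assumes "\<And>n. 0 \<le> c n" "\<And>n. c n \<le> B" "0 \<le> B"
  shows "0 \<le> dyadic_step c z" "dyadic_step c z \<le> B"
proof -
  have "dyadic_step c z = 0 \<or> (\<exists>n. dyadic_step c z = c n)"
    using dyadic_step_eq dyadic_step_eq_0 dyadic_shell_exists by (metis linorder_not_less)
  then show "0 \<le> dyadic_step c z" "dyadic_step c z \<le> B" using assms by auto
qed

lemma nn_integral_lebesgue_on_le_lborel:
  assumes "K \<in> sets lebesgue"
  shows "(\<integral>\<^sup>+ z. F z \<partial>lebesgue_on K) \<le> (\<integral>\<^sup>+ z. F z \<partial>lborel)"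
proof -
  have "(\<integral>\<^sup>+ z. F z \<partial>lebesgue_on K) = (\<integral>\<^sup>+ z. F z * indicator K z \<partial>lebesgue)"
    using assms by (intro nn_integral_restrict_space) auto
  also have "\<dots> \<le> (\<integral>\<^sup>+ z. F z \<partial>lebesgue)"
    by (rule nn_integral_mono) (auto simp: indicator_def)
  finally show ?thesis by (simp add: nn_integral_completion)
qed

text \<open>
  A step function \<open>g\<close> on the shells is in \<open>L\<^sup>p\<close> as soon as its values satisfy the summability condition,
  so \<open>\<bar>z\<bar> powr s * g\<close> lies in the weighted space. With \<open>m\<close> in place of \<open>s\<close> the unweighted function
  gains the factor \<open>\<bar>z\<bar> powr (s - m)\<close>, which is at least \<open>(2 powr (m - s)) ^ n\<close> on the shell of
  index \<open>n\<close>.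
\<close>

lemma not_weighted_Lp_loc_subset:
  assumes p: "1 \<le> p" and c: "\<And>n. 0 \<le> c n"
    and inLp: "if p = \<infinity> then (\<forall>n. c n \<le> B) else summable (\<lambda>n. c n powr enn2real p * (1/4) ^ n)"
    and m: "s \<le> m" and notL1: "\<not> summable (\<lambda>n. (2 powr (m - s)) ^ n * c n * (1/4) ^ n)"
  shows "\<not> weighted_Lp_loc s p \<subseteq> weighted_Lp_loc m 1"
proof
  assume sub: "weighted_Lp_loc s p \<subseteq> weighted_Lp_loc m 1"
  define f where "f z = complex_of_real (cmod z powr s * dyadic_step c z)" for z
  have pos: "0 \<le> dyadic_step c z" for z
    using dyadic_step_eq dyadic_step_eq_0 dyadic_shell_exists c
    by (metis linorder_not_less order_refl)
  have f_borel: "f \<in> borel_measurable borel" unfolding f_def by measurable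
  then have f_leb: "f \<in> borel_measurable lebesgue" by (simp add: measurable_completion)
  have f_on: "f \<in> borel_measurable (lebesgue_on K)" for K
    using f_borel by (rule borel_measurable_lebesgue_onI)
  have uw: "cmod (unweight t f z) = cmod z powr (s - t) * dyadic_step c z" for t z
    using pos[of z] by (cases "z = 0")
      (auto simp: cmod_unweight f_def norm_mult abs_mult powr_diff powr_minus_divide dyadic_step_eq_0)
  have us: "cmod (unweight s f z) = dyadic_step c z" for z
    by (cases "z = 0") (simp_all add: uw dyadic_step_eq_0)
  have "f \<in> weighted_Lp_loc s p"
    unfolding weighted_Lp_loc_def
  proof (intro CollectI conjI allI impI f_leb)
    fix K :: "complex set" assume "compact K"
    then have K: "K \<in> sets lebesgue" by (simp add: borel_compact)
    have meas: "unweight s f \<in> borel_measurable (lebesgue_on K)"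
      by (rule unweight_measurable[OF f_on])
    show "unweight s f \<in> Lp_space p (lebesgue_on K)"
    proof (cases "p = \<infinity>")
      case True
      have B: "c n \<le> B" for n using inLp True by simp
      with c[of 0] have "0 \<le> B" by (meson order_trans)
      then have "AE z in lebesgue_on K. cmod (unweight s f z) \<le> B"
        using dyadic_step_bounds[OF c B] by (simp add: us)
      from Lp_top_leI[OF meas this \<open>0 \<le> B\<close>] show ?thesis using True by simp
    next
      case False
      have "(\<integral>\<^sup>+ z. ennreal (dyadic_step c z powr enn2real p) \<partial>lborel) < \<infinity>"
      proof (rule nn_integral_dyadic_le)
        show "ennreal (dyadic_step c z powr enn2real p) \<le> ennreal (c n powr enn2real p)"
          if "z \<in> dyadic_shell n" for n z
          using that by (simp add: dyadic_step_eq)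
        show "ennreal (dyadic_step c z powr enn2real p) = 0" if "z = 0 \<or> 1 < cmod z" for z
          using that by (simp add: dyadic_step_eq_0)
      qed (use inLp False in auto)
      then show ?thesis
        using nn_integral_lebesgue_on_le_lborel[OF K] meas False
        by (auto simp: Lp_finite_iff us intro: le_less_trans)
    qed
  qed
  with sub have "unweight m f \<in> Lp_space 1 (lebesgue_on (cball 0 1))"
    by (auto simp: weighted_Lp_loc_def)
  then have "(\<integral>\<^sup>+ z. ennreal (cmod z powr (s - m) * dyadic_step c z) \<partial>lebesgue_on (cball 0 1)) < \<infinity>"
    using pos by (simp add: Lp_finite_iff uw)
  also have "(\<integral>\<^sup>+ z. ennreal (cmod z powr (s - m) * dyadic_step c z) \<partial>lebesgue_on (cball 0 1))
      = (\<integral>\<^sup>+ z. ennreal (cmod z powr (s - m) * dyadic_step c z) * indicator (cball 0 1) z \<partial>lebesgue)"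
    by (rule nn_integral_restrict_space) auto
  also have "\<dots> = (\<integral>\<^sup>+ z. ennreal (cmod z powr (s - m) * dyadic_step c z) \<partial>lebesgue)"
    by (rule nn_integral_cong) (auto simp: indicator_def dyadic_step_eq_0)
  also have "\<dots> = (\<integral>\<^sup>+ z. ennreal (cmod z powr (s - m) * dyadic_step c z) \<partial>lborel)"
    by (rule nn_integral_completion)
  also have "\<dots> = \<infinity>"
  proof (rule nn_integral_dyadic_ge[where a = "\<lambda>n. (2 powr (m - s)) ^ n * c n", OF _ _ _ _ notL1])
    show "ennreal (cmod z powr (s - m) * dyadic_step c z) = 0" if "z = 0 \<or> 1 < cmod z" for z
      using that by (simp add: dyadic_step_eq_0)
    show "ennreal ((2 powr (m - s)) ^ n * c n) \<le> ennreal (cmod z powr (s - m) * dyadic_step c z)"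
      if z: "z \<in> dyadic_shell n" for n z
    proof -
      have "0 < cmod z" "cmod z \<le> (1/2) ^ n"
        using z by (auto simp: dyadic_shell_def intro: le_less_trans[rotated])
      then have "((1/2) ^ n) powr (s - m) \<le> cmod z powr (s - m)"
        using m by (intro powr_mono2') auto
      then show ?thesis
        using z c[of n] by (auto simp: dyadic_step_eq half_power_powr intro!: ennreal_leI mult_right_mono)
    qed
  qed (use c in auto)
  finally show False by simp
qed

text \<open>
  Sufficiency is duality. For necessity a step function witnesses failure in each case. The critical
  case \<open>m - s = 2 - 2 / p\<close> with \<open>1 < p < \<infinity>\<close> requires a logarithmic refinement: the step values
  \<open>4\<^sup>n\<^sup>/\<^sup>p / (n + 1)\<close> lead to \<open>\<Sum> 1 / (n + 1)\<^sup>p < \<infinity>\<close> in \<open>L\<^sup>p\<close>, but to the harmonic series in the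
  weighted \<open>L\<^sup>1\<close> norm. This case excludes equality, in contrast to \<open>p = 1\<close>.
\<close>

lemma weighted_Lp_loc_subset_iff:
  assumes p: "1 \<le> p"
  shows "weighted_Lp_loc s p \<subseteq> weighted_Lp_loc (of_int m) 1 \<longleftrightarrow>
    (if p = 1 then of_int m \<le> s else of_int m < s + (2 - 2 / enn2real p))"
proof
  assume R: "if p = 1 then of_int m \<le> s else of_int m < s + (2 - 2 / enn2real p)"
  show "weighted_Lp_loc s p \<subseteq> weighted_Lp_loc (of_int m) 1"
  proof
    fix f assume f: "f \<in> weighted_Lp_loc s p"
    show "f \<in> weighted_Lp_loc (of_int m) 1"
      unfolding weighted_Lp_loc_def
    proof (intro CollectI conjI allI impI)
      show f_leb: "f \<in> borel_measurable lebesgue" using f by (simp add: weighted_Lp_loc_def)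
      fix K :: "complex set" assume K: "compact K"
      then have K': "K \<in> sets lebesgue" "bounded K" by (simp_all add: borel_compact compact_imp_bounded)
      have "unweight s f \<in> Lp_space p (lebesgue_on K)"
        using f K by (simp add: weighted_Lp_loc_def)
      from nn_integral_weight_finite[OF K' p this, of "s - of_int m"] R
      have "(\<integral>\<^sup>+ z. ennreal (cmod (unweight (of_int m) f z)) \<partial>lebesgue_on K) < \<infinity>"
        by (auto simp: cmod_unweight_shift[of "of_int m" f _ s] split: if_splits)
      moreover have "unweight (of_int m) f \<in> borel_measurable (lebesgue_on K)"
        using f_leb by (intro unweight_measurable measurable_restrict_space1)
      ultimately show "unweight (of_int m) f \<in> Lp_space 1 (lebesgue_on K)"
        by (simp add: Lp_finite_iff)
    qed
  qed
next
  assume L: "weighted_Lp_loc s p \<subseteq> weighted_Lp_loc (of_int m) 1"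
  show "if p = 1 then of_int m \<le> s else of_int m < s + (2 - 2 / enn2real p)"
  proof (rule ccontr)
    assume neg: "\<not> ?thesis"
    consider "p = 1" | "p = \<infinity>" | "p \<noteq> 1" "p \<noteq> \<infinity>" by blast
    then show False
    proof cases
      case 1
      define \<delta> where "\<delta> = of_int m - s"
      have \<delta>: "0 < \<delta>" using neg 1 by (simp add: \<delta>_def)
      define c where "c n = 4 ^ n * (2 powr (- \<delta>)) ^ n" for n :: nat
      have "summable (\<lambda>n. (2 powr (- \<delta>)) ^ n :: real)"
        using \<delta> powr_less_mono[of "- \<delta>" 0 2] by (intro summable_geometric) simp
      then have 1: "summable (\<lambda>n. c n powr enn2real p * (1/4) ^ n)"
        using 1 by (simp add: c_def power_divide)
      have "(2 powr (of_int m - s)) ^ n * c n * (1/4) ^ n = 1" for n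
      proof -
        have "(2 powr (of_int m - s)) ^ n * c n * (1/4) ^ n = ((2 powr \<delta>) * (2 powr (- \<delta>))) ^ n"
          unfolding c_def power_mult_distrib by (simp add: \<delta>_def power_divide)
        then show ?thesis by (simp flip: powr_add)
      qed
      then have "\<not> summable (\<lambda>n. (2 powr (of_int m - s)) ^ n * c n * (1/4) ^ n)"
        using summable_LIMSEQ_zero[of "\<lambda>n::nat. 1::real"] by (auto simp: LIMSEQ_const_iff)
      then show False
        using not_weighted_Lp_loc_subset[OF p, of c 0 s "of_int m"] 1 L \<open>p = 1\<close> \<delta>
        by (auto simp: c_def \<delta>_def)
    next
      case 2
      have ge: "2 \<le> of_int m - s" using neg 2 by simp
      have ge1: "1 \<le> (2 powr (of_int m - s)) ^ n * 1 * (1/4::real) ^ n" for n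
      proof -
        have "(2::real) powr 2 \<le> 2 powr (of_int m - s)" using ge by (intro powr_mono) auto
        then have "4 ^ n \<le> (2 powr (of_int m - s) :: real) ^ n" by (intro power_mono) auto
        then show ?thesis by (simp add: power_divide)
      qed
      have "\<not> summable (\<lambda>n. (2 powr (of_int m - s)) ^ n * 1 * (1/4::real) ^ n)"
      proof
        assume "summable (\<lambda>n. (2 powr (of_int m - s)) ^ n * 1 * (1/4::real) ^ n)"
        from LIMSEQ_le_const[OF summable_LIMSEQ_zero[OF this], of 1] ge1 show False by auto
      qed
      then show False
        using not_weighted_Lp_loc_subset[OF p, of "\<lambda>_. 1" 1 s "of_int m"] L 2 ge by simp
    next
      case 3
      define P where "P = enn2real p"
      have P: "1 < P" using enn2real_gt_one[OF p 3] by (simp add: P_def)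
      have ge: "2 - 2 / P \<le> of_int m - s" using neg 3 by (simp add: P_def)
      have "2 / P < 2" using P by (simp add: field_simps)
      define c where "c n = (4 powr (1 / P)) ^ n / real (Suc n)" for n
      have "c n powr P * (1/4) ^ n = real (Suc n) powr (- P)" for n
      proof -
        have "((4 powr (1 / P)) ^ n) powr P = (4::real) ^ n"
        proof -
          have "((4::real) powr (1 / P)) ^ n = 4 powr (real n / P)"
            by (simp add: powr_powr flip: powr_realpow)
          then show ?thesis using P by (simp add: powr_powr powr_realpow)
        qed
        then show ?thesis
          by (simp add: c_def powr_divide powr_minus_divide power_divide)
      qed
      moreover have "summable (\<lambda>n. real (Suc n) powr (- P))"
        using P summable_Suc_iff[of "\<lambda>n. real n powr (- P)"] by (simp add: summable_real_powr_iff)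
      ultimately have 1: "summable (\<lambda>n. c n powr enn2real p * (1/4) ^ n)"
        by (simp add: P_def)
      have "real (Suc n) powr (-1) \<le> (2 powr (of_int m - s)) ^ n * c n * (1/4) ^ n" for n
      proof -
        have "(2::real) powr (2 - 2 / P) \<le> 2 powr (of_int m - s)" using ge by (intro powr_mono) auto
        moreover have "(2::real) powr (2 - 2 / P) * 4 powr (1 / P) = 4"
        proof -
          have "(4::real) powr (1 / P) = (2 powr 2) powr (1 / P)" by simp
          then have "(4::real) powr (1 / P) = 2 powr (2 / P)" by (simp only: powr_powr) simp
          then show ?thesis by (simp flip: powr_add)
        qed
        ultimately have "4 \<le> (2 powr (of_int m - s)) * (4::real) powr (1 / P)"
          by (metis mult_right_mono powr_ge_zero)
        then have "4 ^ n \<le> ((2 powr (of_int m - s)) * (4::real) powr (1 / P)) ^ n"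
          by (intro power_mono) auto
        then have "4 ^ n / (4 ^ n * real (Suc n)) \<le> ((2 powr (of_int m - s)) * (4::real) powr (1 / P)) ^ n / (4 ^ n * real (Suc n))"
          by (intro divide_right_mono) auto
        then show ?thesis
          unfolding c_def power_mult_distrib by (simp add: power_divide powr_minus_divide mult_ac)
      qed
      moreover have "\<not> summable (\<lambda>n. real (Suc n) powr (-1))"
        unfolding summable_Suc_iff[of "\<lambda>n. real n powr (-1)"] summable_real_powr_iff by simp
      ultimately have "\<not> summable (\<lambda>n. (2 powr (of_int m - s)) ^ n * c n * (1/4) ^ n)"
        using summable_comparison_test'[of _ 0 "\<lambda>n. real (Suc n) powr (-1)"] by fastforce
      then show False
        using not_weighted_Lp_loc_subset[OF p, of c 0 s "of_int m"] 1 L 3 ge \<open>2 / P < 2\<close>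
        by (auto simp: c_def)
    qed
  qed
qed

lemma dbar_weight_eq:
  assumes p: "1 \<le> p"
  shows "dbar_weight p s = (if p = 1 then \<lfloor>s\<rfloor> else \<lceil>s + (2 - 2 / enn2real p)\<rceil> - 1)"
  unfolding dbar_weight_def weighted_Lp_loc_subset_iff[OF p]
  by (rule Greatest_equality) (auto split: if_splits simp: le_floor_iff; linarith)+

text \<open>
  Both bounds express that \<open>dbar_weight p s\<close> is the greatest admissible integer: it is admissible itself,
  and its successor is not.
\<close>

lemma dbar_weight_bounds:
  fixes s :: real
  assumes p: "1 \<le> p"
  defines "\<sigma> \<equiv> s - of_int (dbar_weight p s)"
  shows "if p = 1 then 0 \<le> \<sigma> else - (2 - 2 / enn2real p) < \<sigma>"
    and "\<sigma> \<le> 2 / enn2real p - 1"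
  unfolding \<sigma>_def dbar_weight_eq[OF p]
  by (auto split: if_splits) linarith+

section \<open>The weighted Cauchy kernel\<close>

lemma AE_lebesgue_on_nonzero: "D \<in> sets lebesgue \<Longrightarrow> AE z in lebesgue_on D. (z::complex) \<noteq> 0"
proof -
  assume D: "D \<in> sets lebesgue"
  have "AE z in lborel. (z::complex) \<noteq> 0" by (rule AE_lborel_singleton)
  then have "AE z in lebesgue. (z::complex) \<noteq> 0" by (rule AE_completion)
  then show ?thesis
    using D by (subst AE_restrict_space_iff) (auto elim: eventually_mono)
qed

text \<open>
  With \<open>\<sigma> = s - k\<close>, this is the modulus of the kernel of \<open>dbar_op k D\<close>, up to the factor \<open>1 / \<pi>\<close>, when its
  argument is written as \<open>\<bar>y\<bar> powr s * g y\<close> and its value is divided by \<open>\<bar>z\<bar> powr (s + 1 - e)\<close>.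
\<close>

definition cauchy_kernel :: "real \<Rightarrow> real \<Rightarrow> complex \<Rightarrow> complex \<Rightarrow> real" where
  "cauchy_kernel \<sigma> e z y = cmod z powr (e - 1 - \<sigma>) * (cmod y powr \<sigma> / cmod (y - z))"

lemma cauchy_kernel_nonneg: "0 \<le> cauchy_kernel \<sigma> e z y"
  by (simp add: cauchy_kernel_def)

lemma cauchy_kernel_measurable:
  "case_prod (cauchy_kernel \<sigma> e) \<in> borel_measurable (lebesgue_on D \<Otimes>\<^sub>M lebesgue_on D)"
proof -
  have id: "(\<lambda>z::complex. z) \<in> borel_measurable (lebesgue_on D)"
    by (rule borel_measurable_lebesgue_onI) simp
  note [measurable] = measurable_compose[OF measurable_fst id] measurable_compose[OF measurable_snd id]
  show ?thesis unfolding cauchy_kernel_def case_prod_beta by measurable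
qed

text \<open>
  For \<open>p = 1\<close> the column integrals and for \<open>p = \<infinity>\<close> the row integrals are bounded, the powers of \<open>\<bar>z\<bar>\<close> in
  \<open>nn_integral_homogeneous_kernel_le\<close> cancelling exactly. In between, Schur's test is applied with the
  weight \<open>\<bar>z\<bar> powr (- l)\<close>. The hypotheses of the kernel estimate for rows and columns become
  \<open>\<sigma> + 1 - e \<le> l q \<le> \<sigma> + 2 - e\<close> and \<open>- \<sigma> \<le> l p \<le> 1 - \<sigma>\<close>, and the bounds on \<open>\<sigma>\<close> are what makes
  these two intervals for \<open>l\<close> meet.
\<close>

lemma Lp_bounded_cauchy_kernel:
  fixes D :: "complex set" and \<sigma> e :: real
  assumes D: "D \<in> sets lebesgue" "bounded D" and p: "1 \<le> p"
    and lower: "if p = 1 then 0 \<le> \<sigma> else e \<le> \<sigma> + (2 - 2 / enn2real p)"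
    and upper: "\<sigma> \<le> 2 / enn2real p - 1" and e: "0 < e" "e \<le> 1"
  shows "Lp_bounded_kernel p (lebesgue_on D) (cauchy_kernel \<sigma> e)"
proof -
  let ?M = "lebesgue_on D"
  obtain R where R: "D \<subseteq> ball 0 R" "0 < R"
    using bounded_subset_ballD[OF D(2)] by blast
  have "D \<in> lmeasurable" using D by (intro bounded_set_imp_lmeasurable) auto
  then interpret finite_measure ?M by (rule finite_measure_lebesgue_on)
  have M: "sigma_finite_measure ?M" by (rule sigma_finite_measure_axioms)
  note kernel_le = nn_integral_homogeneous_kernel_le[OF D(1) R e]
  consider "p = 1" | "p = \<infinity>" | "p \<noteq> 1" "p \<noteq> \<infinity>" by blast
  then show ?thesis
  proof cases
    case 1
    have "-1 \<le> (e - 1 - \<sigma>) + 1 - e" "(e - 1 - \<sigma>) + 1 - e \<le> 0" using 1 lower upper by auto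
    from kernel_le[OF this] obtain C where C: "0 \<le> C"
      "\<And>z \<alpha>. z \<in> D \<Longrightarrow> (\<integral>\<^sup>+ y. ennreal (cmod z powr \<alpha> * (cmod y powr (e - 1 - \<sigma>) / cmod (y - z))) \<partial>?M)
        \<le> ennreal (C * cmod z powr (\<alpha> + (e - 1 - \<sigma>) + 1 - e))" by blast
    show ?thesis
      unfolding 1
    proof (rule Lp_bounded_kernel_one[OF M cauchy_kernel_measurable cauchy_kernel_nonneg C(1)])
      fix y assume "y \<in> space ?M"
      then have "(\<integral>\<^sup>+ x. ennreal (cmod y powr \<sigma> * (cmod x powr (e - 1 - \<sigma>) / cmod (x - y))) \<partial>?M)
          \<le> ennreal (C * cmod y powr (\<sigma> + (e - 1 - \<sigma>) + 1 - e))"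
        by (intro C(2)) simp
      also have "\<dots> \<le> ennreal C"
        using C(1) by (intro ennreal_leI) (simp add: powr_def)
      finally show "(\<integral>\<^sup>+ x. ennreal (cauchy_kernel \<sigma> e x y) \<partial>?M) \<le> ennreal C"
        by (simp add: cauchy_kernel_def norm_minus_commute mult_ac)
    qed
  next
    case 2
    have "-1 \<le> \<sigma> + 1 - e" "\<sigma> + 1 - e \<le> 0" using 2 lower upper e by auto
    from kernel_le[OF this] obtain C where C: "0 \<le> C"
      "\<And>z \<alpha>. z \<in> D \<Longrightarrow> (\<integral>\<^sup>+ y. ennreal (cmod z powr \<alpha> * (cmod y powr \<sigma> / cmod (y - z))) \<partial>?M)
        \<le> ennreal (C * cmod z powr (\<alpha> + \<sigma> + 1 - e))" by blast
    show ?thesis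
      unfolding 2
    proof (rule Lp_bounded_kernel_top[OF M cauchy_kernel_measurable cauchy_kernel_nonneg C(1)])
      fix z assume "z \<in> space ?M"
      then have "(\<integral>\<^sup>+ y. ennreal (cauchy_kernel \<sigma> e z y) \<partial>?M)
          \<le> ennreal (C * cmod z powr ((e - 1 - \<sigma>) + \<sigma> + 1 - e))"
        unfolding cauchy_kernel_def by (intro C(2)) simp
      also have "\<dots> \<le> ennreal C"
        using C(1) by (intro ennreal_leI) (simp add: powr_def)
      finally show "(\<integral>\<^sup>+ y. ennreal (cauchy_kernel \<sigma> e z y) \<partial>?M) \<le> ennreal C" .
    qed
  next
    case 3
    define P where "P = enn2real p"
    have pP: "p = ennreal P" using 3 by (simp add: P_def less_top)
    have "1 < P" using enn2real_gt_one[OF p 3] by (simp add: P_def)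
    define q where "q = P / (P - 1)"
    have q: "1 < q" "1 / q + 1 / P = 1" using \<open>1 < P\<close> by (auto simp: q_def field_simps)
    have Pq: "P / q = P - 1" using \<open>1 < P\<close> by (simp add: q_def)
    have lower': "e * (P - 1) \<le> \<sigma> * P + 2 * (P - 1)"
    proof -
      have "e * (P - 1) \<le> e * P" using e by (intro mult_left_mono) auto
      also have "\<dots> \<le> (\<sigma> + (2 - 2 / P)) * P"
        using lower 3 \<open>1 < P\<close> by (intro mult_right_mono) (auto simp: P_def)
      also have "\<dots> = \<sigma> * P + 2 * (P - 1)" using \<open>1 < P\<close> by (simp add: field_simps)
      finally show ?thesis .
    qed
    have upper': "\<sigma> * P \<le> 2 - P"
      using upper \<open>1 < P\<close> by (simp add: field_simps flip: P_def)
    have "0 \<le> e * (P - 1)" using e \<open>1 < P\<close> by simp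
    \<comment> \<open>The larger one of the two lower end points, which lies in both intervals.\<close>
    define l where "l = max ((\<sigma> + 1 - e) / q) (- \<sigma> / P)"
    have l: "\<sigma> + 1 - e \<le> l * q" "l * q \<le> \<sigma> + 2 - e" "- \<sigma> \<le> l * P" "l * P \<le> 1 - \<sigma>"
    proof -
      have "(\<sigma> + 1 - e) / q \<le> l" "- \<sigma> / P \<le> l" by (simp_all add: l_def)
      then show "\<sigma> + 1 - e \<le> l * q" "- \<sigma> \<le> l * P"
        using q \<open>1 < P\<close> by (simp_all only: pos_divide_le_eq)
      have "- \<sigma> / P * q \<le> \<sigma> + 2 - e"
        using lower' \<open>1 < P\<close> by (simp add: q_def field_simps)
      then show "l * q \<le> \<sigma> + 2 - e" using q by (simp add: l_def max_def)
      have "(\<sigma> + 1 - e) / q * P = (\<sigma> + 1 - e) * (P - 1)"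
        using Pq by (metis times_divide_eq_left times_divide_eq_right)
      also have "\<dots> \<le> 1 - \<sigma>" using upper' \<open>0 \<le> e * (P - 1)\<close> by (simp add: algebra_simps)
      finally show "l * P \<le> 1 - \<sigma>" using \<open>1 < P\<close> by (simp add: l_def max_def)
    qed
    let ?w = "\<lambda>z. cmod z powr (- l)"
    have "-1 \<le> (\<sigma> - l * q) + 1 - e" "(\<sigma> - l * q) + 1 - e \<le> 0" using l by auto
    from kernel_le[OF this] obtain C1 where C1: "0 \<le> C1"
      "\<And>z \<alpha>. z \<in> D \<Longrightarrow> (\<integral>\<^sup>+ y. ennreal (cmod z powr \<alpha> * (cmod y powr (\<sigma> - l * q) / cmod (y - z))) \<partial>?M)
        \<le> ennreal (C1 * cmod z powr (\<alpha> + (\<sigma> - l * q) + 1 - e))" by blast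
    have "-1 \<le> (e - 1 - \<sigma> - l * P) + 1 - e" "(e - 1 - \<sigma> - l * P) + 1 - e \<le> 0" using l by auto
    from kernel_le[OF this] obtain C2 where C2: "0 \<le> C2"
      "\<And>z \<alpha>. z \<in> D \<Longrightarrow> (\<integral>\<^sup>+ y. ennreal (cmod z powr \<alpha> * (cmod y powr (e - 1 - \<sigma> - l * P) / cmod (y - z))) \<partial>?M)
        \<le> ennreal (C2 * cmod z powr (\<alpha> + (e - 1 - \<sigma> - l * P) + 1 - e))" by blast
    have row_eq: "cmod y powr (\<sigma> - l * q) = cmod y powr \<sigma> * ?w y powr q" for y
      by (simp add: powr_powr flip: powr_add)
    have column_eq: "cmod x powr (e - 1 - \<sigma> - l * P) = cmod x powr (e - 1 - \<sigma>) * ?w x powr P" for x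
      by (simp add: powr_powr flip: powr_add)
    show ?thesis
      unfolding pP
    proof (rule Schur_test[OF \<open>1 < P\<close> q M cauchy_kernel_measurable cauchy_kernel_nonneg, where w = ?w and C = "max C1 C2"])
      show "0 \<le> max C1 C2" using C1 by simp
      show "?w \<in> borel_measurable ?M" by (rule borel_measurable_lebesgue_onI) measurable
      show "AE z in ?M. 0 < ?w z"
        using AE_lebesgue_on_nonzero[OF D(1)] by eventually_elim simp
      fix z assume "z \<in> space ?M"
      then have z: "z \<in> D" by simp
      have "(\<integral>\<^sup>+ y. ennreal (cauchy_kernel \<sigma> e z y * ?w y powr q) \<partial>?M)
          = (\<integral>\<^sup>+ y. ennreal (cmod z powr (e - 1 - \<sigma>) * (cmod y powr (\<sigma> - l * q) / cmod (y - z))) \<partial>?M)"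
        unfolding row_eq cauchy_kernel_def by (simp only: mult_ac times_divide_eq_left times_divide_eq_right)
      also have "\<dots> \<le> ennreal (C1 * cmod z powr ((e - 1 - \<sigma>) + (\<sigma> - l * q) + 1 - e))"
        by (rule C1(2)[OF z])
      also have "\<dots> \<le> ennreal (max C1 C2 * ?w z powr q)"
        by (intro ennreal_leI) (simp add: powr_powr mult_right_mono)
      finally show "(\<integral>\<^sup>+ y. ennreal (cauchy_kernel \<sigma> e z y * ?w y powr q) \<partial>?M) \<le> \<dots>" .
      have "(\<integral>\<^sup>+ x. ennreal (cauchy_kernel \<sigma> e x z * ?w x powr P) \<partial>?M)
          = (\<integral>\<^sup>+ x. ennreal (cmod z powr \<sigma> * (cmod x powr (e - 1 - \<sigma> - l * P) / cmod (x - z))) \<partial>?M)"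
        unfolding column_eq cauchy_kernel_def
        by (simp only: mult_ac times_divide_eq_left times_divide_eq_right norm_minus_commute[of z])
      also have "\<dots> \<le> ennreal (C2 * cmod z powr (\<sigma> + (e - 1 - \<sigma> - l * P) + 1 - e))"
        by (rule C2(2)[OF z])
      also have "\<dots> \<le> ennreal (max C1 C2 * ?w z powr P)"
        by (intro ennreal_leI) (simp add: powr_powr mult_right_mono)
      finally show "(\<integral>\<^sup>+ x. ennreal (cauchy_kernel \<sigma> e x z * ?w x powr P) \<partial>?M) \<le> \<dots>" .
    qed simp
  qed
qed

section \<open>The solution operator\<close>

lemma borel_measurable_power_int: "(\<lambda>z::complex. z powi k) \<in> borel_measurable borel"
  unfolding power_int_def by measurable

lemma dbar_integrand_measurable:
  assumes f: "f \<in> borel_measurable (lebesgue_on D)"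
  shows "case_prod (dbar_integrand k f) \<in> borel_measurable (lebesgue_on D \<Otimes>\<^sub>M lebesgue_on D)"
    and "dbar_integrand k f z \<in> borel_measurable (lebesgue_on D)"
proof -
  have id: "(\<lambda>z::complex. z) \<in> borel_measurable (lebesgue_on D)"
    by (rule borel_measurable_lebesgue_onI) simp
  have pw: "(\<lambda>z::complex. z powi k) \<in> borel_measurable (lebesgue_on D)"
    by (rule borel_measurable_lebesgue_onI borel_measurable_power_int)+
  show "dbar_integrand k f z \<in> borel_measurable (lebesgue_on D)"
    unfolding dbar_integrand_def using f pw id by measurable
  note [measurable] = measurable_compose[OF measurable_fst id] measurable_compose[OF measurable_snd id]
    measurable_compose[OF measurable_snd f] measurable_compose[OF measurable_snd pw]
  show "case_prod (dbar_integrand k f) \<in> borel_measurable (lebesgue_on D \<Otimes>\<^sub>M lebesgue_on D)"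
    unfolding dbar_integrand_def case_prod_beta by measurable
qed

lemma dbar_op_measurable:
  assumes M: "sigma_finite_measure (lebesgue_on D)" and f: "f \<in> borel_measurable (lebesgue_on D)"
  shows "dbar_op k D f \<in> borel_measurable (lebesgue_on D)"
proof -
  interpret sigma_finite_measure "lebesgue_on D" by fact
  have [measurable]: "(\<lambda>z::complex. z powi k) \<in> borel_measurable (lebesgue_on D)"
    by (rule borel_measurable_lebesgue_onI borel_measurable_power_int)+
  have [measurable]: "(\<lambda>z. LINT y|lebesgue_on D. dbar_integrand k f z y) \<in> borel_measurable (lebesgue_on D)"
    by (rule borel_measurable_lebesgue_integral) (rule dbar_integrand_measurable(1)[OF f])
  show ?thesis unfolding dbar_op_def by measurable
qed

lemma norm_dbar_integrand:
  assumes "y \<noteq> 0"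
  shows "cmod (dbar_integrand k f z y)
    = 2 * (cmod y powr (s - of_int k) / cmod (y - z) * cmod (unweight s f y))"
proof -
  have "cmod (f y) = cmod y powr s * cmod (unweight s f y)"
    using assms by (simp add: cmod_unweight powr_minus)
  moreover have "cmod (y powi k) = cmod y powr of_int k"
    using assms by (simp add: norm_power_int powr_real_of_int')
  ultimately show ?thesis
    by (simp add: dbar_integrand_def norm_mult norm_divide powr_diff)
qed

text \<open>
  The factor \<open>2\<close> is \<open>\<bar>- 2 \<i>\<bar>\<close>. The origin has to be left out in \<open>y\<close>, since there the two integrands may
  differ; at \<open>z = 0\<close> both sides vanish.
\<close>

lemma nn_integral_dbar_integrand:
  assumes D: "D \<in> sets lebesgue" and f: "f \<in> borel_measurable (lebesgue_on D)"
  shows "ennreal (cmod z powr (e - 1 - (s - of_int k))) *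
      (\<integral>\<^sup>+ y. ennreal (cmod (dbar_integrand k f z y)) \<partial>lebesgue_on D)
    = 2 * kernel_op (lebesgue_on D) (cauchy_kernel (s - of_int k) e) (unweight s f) z"
proof -
  let ?M = "lebesgue_on D"
  have id: "(\<lambda>z::complex. z) \<in> borel_measurable ?M"
    by (rule borel_measurable_lebesgue_onI) simp
  note [measurable] = id dbar_integrand_measurable(2)[OF f] unweight_measurable[OF f]
  have "ennreal (cmod z powr (e - 1 - (s - of_int k))) * (\<integral>\<^sup>+ y. ennreal (cmod (dbar_integrand k f z y)) \<partial>?M)
      = (\<integral>\<^sup>+ y. ennreal (cmod z powr (e - 1 - (s - of_int k))) * ennreal (cmod (dbar_integrand k f z y)) \<partial>?M)"
    by (rule nn_integral_cmult[symmetric]) measurable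
  also have "\<dots> = (\<integral>\<^sup>+ y. 2 * ennreal (cauchy_kernel (s - of_int k) e z y * cmod (unweight s f y)) \<partial>?M)"
  proof (rule nn_integral_cong_AE)
    show "AE y in ?M. ennreal (cmod z powr (e - 1 - (s - of_int k))) * ennreal (cmod (dbar_integrand k f z y))
        = 2 * ennreal (cauchy_kernel (s - of_int k) e z y * cmod (unweight s f y))"
      using AE_lebesgue_on_nonzero[OF D]
    proof eventually_elim
      case (elim y)
      have "cmod z powr (e - 1 - (s - of_int k)) * cmod (dbar_integrand k f z y)
          = 2 * (cauchy_kernel (s - of_int k) e z y * cmod (unweight s f y))"
        unfolding norm_dbar_integrand[OF elim, of k f z s] cauchy_kernel_def by simp
      moreover have "2 * ennreal x = ennreal (2 * x)" if "0 \<le> x" for x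
        using that by (simp add: ennreal_mult)
      ultimately show ?case
        by (simp add: cauchy_kernel_nonneg flip: ennreal_mult')
    qed
  qed
  also have "\<dots> = 2 * kernel_op ?M (cauchy_kernel (s - of_int k) e) (unweight s f) z"
    unfolding kernel_op_def cauchy_kernel_def by (rule nn_integral_cmult) measurable
  finally show ?thesis .
qed

lemma integrable_dbar_integrand:
  assumes D: "D \<in> sets lebesgue" and f: "f \<in> borel_measurable (lebesgue_on D)" and z: "z \<noteq> 0"
    and fin: "kernel_op (lebesgue_on D) (cauchy_kernel (s - of_int k) e) (unweight s f) z < \<infinity>"
  shows "integrable (lebesgue_on D) (dbar_integrand k f z)"
proof -
  have "ennreal (cmod z powr (e - 1 - (s - of_int k))) *
      (\<integral>\<^sup>+ y. ennreal (cmod (dbar_integrand k f z y)) \<partial>lebesgue_on D) < \<infinity>"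
    unfolding nn_integral_dbar_integrand[OF D f] using fin by (simp add: ennreal_mult_less_top)
  then have "(\<integral>\<^sup>+ y. ennreal (cmod (dbar_integrand k f z y)) \<partial>lebesgue_on D) < \<infinity>"
    using z by (auto simp: ennreal_mult_less_top)
  then show ?thesis
    using dbar_integrand_measurable(2)[OF f] by (simp add: integrable_iff_bounded)
qed

text \<open>
  The constant \<open>R powr (\<epsilon> - e)\<close> is the price for estimating the operator with loss \<open>\<epsilon>\<close> by the kernel
  with the smaller loss \<open>e\<close>.
\<close>

lemma norm_dbar_op_le:
  assumes D: "D \<in> sets lebesgue" and f: "f \<in> borel_measurable (lebesgue_on D)"
    and z: "z \<noteq> 0" "cmod z \<le> R" and e: "e \<le> \<epsilon>"
    and fin: "kernel_op (lebesgue_on D) (cauchy_kernel (s - of_int k) e) (unweight s f) z < \<infinity>"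
  shows "cmod (unweight (s + 1 - \<epsilon>) (dbar_op k D f) z)
    \<le> R powr (\<epsilon> - e) / pi *
      enn2real (kernel_op (lebesgue_on D) (cauchy_kernel (s - of_int k) e) (unweight s f) z)"
proof -
  let ?M = "lebesgue_on D" and ?\<sigma> = "s - of_int k"
  let ?S = "kernel_op ?M (cauchy_kernel ?\<sigma> e) (unweight s f) z"
  let ?I = "LINT y|?M. dbar_integrand k f z y"
  have "ennreal (cmod z powr (e - 1 - ?\<sigma>) * cmod ?I)
      \<le> ennreal (cmod z powr (e - 1 - ?\<sigma>)) * (\<integral>\<^sup>+ y. ennreal (cmod (dbar_integrand k f z y)) \<partial>?M)"
    using integral_norm_bound_ennreal[OF integrable_dbar_integrand[OF D f z(1) fin]]
    by (simp add: ennreal_mult' mult_left_mono)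
  also have "\<dots> = 2 * ?S" by (rule nn_integral_dbar_integrand[OF D f])
  also have "\<dots> = ennreal (2 * enn2real ?S)"
    using fin by (simp add: ennreal_mult)
  finally have I: "cmod z powr (e - 1 - ?\<sigma>) * cmod ?I \<le> 2 * enn2real ?S"
    by (simp add: ennreal_le_iff)
  have "cmod (unweight (s + 1 - \<epsilon>) (dbar_op k D f) z)
      = cmod z powr (- (s + 1 - \<epsilon>)) * (cmod z powr of_int k * cmod ?I / (2 * pi))"
    using z by (simp add: cmod_unweight dbar_op_def norm_mult norm_divide norm_power_int powr_real_of_int')
  also have "\<dots> = cmod z powr (\<epsilon> - e) * (cmod z powr (e - 1 - ?\<sigma>) * cmod ?I) / (2 * pi)"
  proof -
    have "cmod z powr (- (s + 1 - \<epsilon>)) * cmod z powr of_int k = cmod z powr (\<epsilon> - e) * cmod z powr (e - 1 - ?\<sigma>)"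
      by (simp add: algebra_simps flip: powr_add)
    then show ?thesis by (metis (no_types, lifting) mult.assoc times_divide_eq_right)
  qed
  also have "\<dots> \<le> R powr (\<epsilon> - e) * (2 * enn2real ?S) / (2 * pi)"
    using z e by (intro divide_right_mono mult_mono[OF _ I] powr_mono2) auto
  finally show ?thesis by simp
qed

theorem theorem2p1:
  fixes D :: "complex set" and p :: ennreal and s :: real and k :: int
  assumes "open D" and "connected D" and "D \<noteq> {}" and "bounded D"
    and "1 \<le> p"
    and "k = dbar_weight p s"
  shows "(\<forall>f \<in> weighted_Lp s p D. AE z in lebesgue_on D.
            integrable (lebesgue_on D) (dbar_integrand k f z)) \<and>
         (\<forall>\<epsilon>>0. bounded_linear_weighted_Lp s p (s + 1 - \<epsilon>) p D (dbar_op k D))"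
proof -
  let ?M = "lebesgue_on D"
  define \<sigma> where "\<sigma> = s - of_int k"
  have D: "D \<in> sets lebesgue" using \<open>open D\<close> by (simp add: borel_open)
  have "D \<in> lmeasurable" using D \<open>bounded D\<close> by (intro bounded_set_imp_lmeasurable) auto
  then interpret finite_measure ?M by (rule finite_measure_lebesgue_on)
  have M: "sigma_finite_measure ?M" by (rule sigma_finite_measure_axioms)
  obtain R where R: "D \<subseteq> ball 0 R"
    using bounded_subset_ballD[OF \<open>bounded D\<close>] by blast
  note lower = dbar_weight_bounds(1)[OF \<open>1 \<le> p\<close>, of s, folded \<open>k = dbar_weight p s\<close>, folded \<sigma>_def]
  note upper = dbar_weight_bounds(2)[OF \<open>1 \<le> p\<close>, of s, folded \<open>k = dbar_weight p s\<close>, folded \<sigma>_def]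
  have exponent: "\<exists>e. 0 < e \<and> e \<le> \<epsilon> \<and> Lp_bounded_kernel p ?M (cauchy_kernel \<sigma> e)" if "0 < \<epsilon>" for \<epsilon>
  proof -
    \<comment> \<open>The strict lower bound on \<open>\<sigma>\<close> for \<open>p \<noteq> 1\<close> is used here: it keeps \<open>e\<close> positive.\<close>
    define e where "e = (if p = 1 then min \<epsilon> 1 else min (min \<epsilon> 1) (\<sigma> + (2 - 2 / enn2real p)))"
    have "0 < e" "e \<le> \<epsilon>" "e \<le> 1" "p \<noteq> 1 \<longrightarrow> e \<le> \<sigma> + (2 - 2 / enn2real p)"
      using lower \<open>0 < \<epsilon>\<close> by (auto simp: e_def)
    then show ?thesis
      using Lp_bounded_cauchy_kernel[OF D \<open>bounded D\<close> \<open>1 \<le> p\<close> _ upper, of e] lower by auto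
  qed
  have f_meas: "f \<in> borel_measurable ?M" and f_Lp: "unweight s f \<in> Lp_space p ?M"
    if "f \<in> weighted_Lp s p D" for f
    using that by (simp_all add: weighted_Lp_def)
  have integrable: "AE z in ?M. integrable ?M (dbar_integrand k f z)" if f: "f \<in> weighted_Lp s p D" for f
  proof -
    obtain e where "Lp_bounded_kernel p ?M (cauchy_kernel \<sigma> e)" using exponent[of 1] by auto
    then have "AE z in ?M. kernel_op ?M (cauchy_kernel \<sigma> e) (unweight s f) z < \<infinity>"
      using f_Lp[OF f] by (auto simp: Lp_bounded_kernel_def)
    then show ?thesis
      using AE_lebesgue_on_nonzero[OF D]
      by eventually_elim (use integrable_dbar_integrand[OF D f_meas[OF f]] in \<open>auto simp: \<sigma>_def\<close>)
  qed
  have "bounded_linear_weighted_Lp s p (s + 1 - \<epsilon>) p D (dbar_op k D)" if "0 < \<epsilon>" for \<epsilon>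
  proof -
    obtain e where e: "0 < e" "e \<le> \<epsilon>" "Lp_bounded_kernel p ?M (cauchy_kernel \<sigma> e)"
      using exponent[OF \<open>0 < \<epsilon>\<close>] by blast
    define S where "S f = kernel_op ?M (cauchy_kernel \<sigma> e) (unweight s f)" for f
    obtain C where C: "0 \<le> C" "\<And>f. f \<in> weighted_Lp s p D \<Longrightarrow>
        (AE z in ?M. S f z < \<infinity>) \<and> (\<lambda>z. complex_of_real (enn2real (S f z))) \<in> Lp_space p ?M \<and>
        Lp_norm p ?M (\<lambda>z. complex_of_real (enn2real (S f z))) \<le> C * Lp_norm p ?M (unweight s f)"
      using e(3) f_Lp unfolding Lp_bounded_kernel_def S_def by blast
    let ?B = "R powr (\<epsilon> - e) / pi"
    have dominated: "dbar_op k D f \<in> weighted_Lp (s + 1 - \<epsilon>) p D"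
        "weighted_Lp_norm (s + 1 - \<epsilon>) p D (dbar_op k D f) \<le> (?B * C) * weighted_Lp_norm s p D f"
      if f: "f \<in> weighted_Lp s p D" for f
    proof -
      have "AE z in ?M. z \<in> D" using AE_space[of ?M] by simp
      then have "AE z in ?M. cmod (unweight (s + 1 - \<epsilon>) (dbar_op k D f) z)
          \<le> ?B * cmod (complex_of_real (enn2real (S f z)))"
        using C(2)[OF f, THEN conjunct1] AE_lebesgue_on_nonzero[OF D]
      proof eventually_elim
        case (elim z)
        then have "cmod z \<le> R" using R by auto
        from norm_dbar_op_le[OF D f_meas[OF f] elim(3) this e(2)] elim(2) show ?case
          by (simp add: S_def \<sigma>_def)
      qed
      note dom = Lp_dominated[OF conjunct1[OF conjunct2[OF C(2)[OF f]]] \<open>1 \<le> p\<close>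
          unweight_measurable[OF dbar_op_measurable[OF M f_meas[OF f]]] _ this]
      show "dbar_op k D f \<in> weighted_Lp (s + 1 - \<epsilon>) p D"
        using dom(1) dbar_op_measurable[OF M f_meas[OF f]] by (simp add: weighted_Lp_def)
      have "Lp_norm p ?M (unweight (s + 1 - \<epsilon>) (dbar_op k D f))
          \<le> ?B * Lp_norm p ?M (\<lambda>z. complex_of_real (enn2real (S f z)))"
        using dom(2) by simp
      also have "\<dots> \<le> ?B * (C * Lp_norm p ?M (unweight s f))"
        using C(2)[OF f] by (intro mult_left_mono) auto
      finally show "weighted_Lp_norm (s + 1 - \<epsilon>) p D (dbar_op k D f) \<le> (?B * C) * weighted_Lp_norm s p D f"
        by (simp add: weighted_Lp_norm_def mult.assoc)
    qed
    show ?thesis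
      unfolding bounded_linear_weighted_Lp_def
    proof (intro conjI ballI allI impI)
      fix f g assume f: "f \<in> weighted_Lp s p D" and g: "g \<in> weighted_Lp s p D"
      show "AE z in ?M. dbar_op k D f z = dbar_op k D g z" if fg: "AE z in ?M. f z = g z"
      proof (rule AE_I2)
        fix z
        have "(LINT y|?M. dbar_integrand k f z y) = (LINT y|?M. dbar_integrand k g z y)"
          using dbar_integrand_measurable(2)[OF f_meas[OF f]] dbar_integrand_measurable(2)[OF f_meas[OF g]]
        proof (rule integral_cong_AE)
          show "AE y in ?M. dbar_integrand k f z y = dbar_integrand k g z y"
            using fg by eventually_elim (simp add: dbar_integrand_def)
        qed
        then show "dbar_op k D f z = dbar_op k D g z" by (simp add: dbar_op_def)
      qed
      show "AE z in ?M. dbar_op k D (\<lambda>w. f w + g w) z = dbar_op k D f z + dbar_op k D g z"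
        using integrable[OF f] integrable[OF g]
      proof eventually_elim
        case (elim z)
        have "dbar_integrand k (\<lambda>w. f w + g w) z = (\<lambda>y. dbar_integrand k f z y + dbar_integrand k g z y)"
          by (auto simp: dbar_integrand_def add_divide_distrib distrib_right)
        then show ?case
          using elim by (simp add: dbar_op_def distrib_left)
      qed
    next
      fix c f assume f: "f \<in> weighted_Lp s p D"
      have "dbar_integrand k (\<lambda>w. c * f w) z = (\<lambda>y. c * dbar_integrand k f z y)" for z
        by (auto simp: dbar_integrand_def)
      then show "AE z in ?M. dbar_op k D (\<lambda>w. c * f w) z = c * dbar_op k D f z"
        by (intro AE_I2) (simp add: dbar_op_def)
    next
      show "\<exists>C. \<forall>f\<in>weighted_Lp s p D.
          weighted_Lp_norm (s + 1 - \<epsilon>) p D (dbar_op k D f) \<le> C * weighted_Lp_norm s p D f"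
        using dominated(2) by blast
    qed (use dominated(1) in blast)
  qed
  with integrable show ?thesis by blast
qed

end
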